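(* Let $\{(x^k,w^k)\}_{k\in\mathbb N}$ be an infinite sequence generated by algorithm PPSNA (described in the context), where the inner solver SNA is stopped with criteria (C1) and (C2), i.e. for every $k$, $(x^{k+1},w^{k+1})$ satisfies $$\text{(C1)}\ \ \Xi_k(w^{k+1})-\Xi_k(\tilde w^k)\le\frac1{4\gamma_k}\|w^{k+1}-w^k\|_M^2,\qquad \text{(C2)}\ \ G_k(x^{k+1},w^{k+1})\le\frac{\varepsilon_k^2}{2\gamma_k},\ \ \varepsilon_k\ge0,\ \sum_{k=0}^\infty\varepsilon_k<\infty .$$ Suppose that: (1) $f$ is coercive: $\liminf_{\|x\|\to\infty}f(x)/\|x\|=\infty$; (2) $\{w^k\}_{k\in\mathbb N}$ is bounded, and $g^*$ is continuous on its domain, i.e. $g^*(y^\nu)\to g^*(\bar y)$ whenever $\bar y,y^\nu\in\operatorname{dom}g^*$ and $y^\nu\to\bar y$; (3) the set $\{x: x\in\operatorname{ri}(\operatorname{dom}f),\ Ax\in\operatorname{ri}(\operatorname{dom}g),\ (Bx)_{T_\infty}=0\}$ is nonempty, where $T_\infty$ is the eventual value of the index sets $T_k$ (under (1), (2), (C1), (C2) one has $T_k=T_\infty$ for all sufficiently large $k$), and where "$\operatorname{ri}$" can be omitted for $f$ (resp. $g$) if $f$ (resp. $g$) is polyhedral convex. Then: (i) $\{w^k\}_{k\in\mathbb N}$ converges to a stationary point of (D), which is also a local minimizer of (D). (ii) Each accumulation point of $\{x^k\}_{k\in\mathbb N}$ is a stationary point of (P), which is also a local minimizer of (P).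
   Context: **Data.** $f:\mathbb R^n\to(-\infty,\infty]$ and $g:\mathbb R^m\to(-\infty,\infty]$ are proper, closed, convex; $A:\mathbb R^n\to\mathbb R^m$ and $B:\mathbb R^n\to\mathbb R^p$ are linear (identified with matrices); $Qx:=[Ax;Bx]\in\mathbb R^{m+p}$; $M:=QQ^\top+I$; $\|w\|_M^2:=\langle w,Mw\rangle$. Vectors of $\mathbb R^{m+p}$ are written $w=[y;z]$ with $y\in\mathbb R^m$, $z\in\mathbb R^p$. $f^*,g^*$ are the Fenchel conjugates. $\lambda,\mu\in\mathbb R^p$ have positive entries, $\Phi_\lambda(u)=\sum_{i=1}^p\lambda_i\mathbb 1_{\{u_i\ne0\}}$, and similarly $\Phi_\mu$. For $T\subseteq[p]=\{1,\dots,p\}$, $\overline T=[p]\setminus T$, $z_T$ is the subvector of $z$ indexed by $T$, $B_{T:}$ the submatrix of rows indexed by $T$; $\mathcal I(z)=\{i:z_i\neq0\}$. $\operatorname{ri}$ is relative interior. For $\sigma>0$ and $\psi$ proper closed convex, $\mathcal E_{\sigma\psi}(p)=\min_x\{\frac1{2\sigma}\|x-p\|^2+\psi(x)\}$ and $\mathrm{Prox}_{\sigma\psi}(p)$ is the unique minimizer. **Problems.** (P): $\min_{x\in\mathbb R^n}f(x)+g(Ax)+\Phi_\lambda(Bx)$. (D): $\min_{w=[y;z]}\Xi(w)+\Phi_\mu(z)$ with $\Xi(w)=f^*(-Q^\top w)+g^*(y)$. The limiting subdifferential of $\Phi_\lambda$ (and of $\Phi_\mu$) at $z$ is $\{v\in\mathbb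 R^p:v_i=0\text{ whenever }z_i\ne0\}$. A point $x$ is stationary for (P) if $0\in\partial f(x)+A^\top\partial g(Ax)+B^\top\partial\Phi_\lambda(Bx)$. A point $w=[y;z]$ is stationary for (D) if there is $\xi\in\partial f^*(-Q^\top w)$ with $A\xi\in\partial g^*(y)$ and $B\xi\in\partial\Phi_\mu(z)$. **Algorithm PPSNA.** Input $x^0\in\mathbb R^n$, $w^0=[y^0;z^0]$ with $y^0\in\operatorname{dom}g^*$, and $\gamma_0>0$. The parameters satisfy $\gamma_k\uparrow\gamma_\infty<\infty$ (nondecreasing). For $k=0,1,\dots$, with $\Xi_k(w)=\Xi(w)+\frac1{2\gamma_k}\|w-w^k\|_M^2$: 1. (Coordinate minimization) Successively for $i=1,\dots,p$ choose $\tilde z_i^k\in\operatorname{argmin}_{t\in\mathbb R}\Xi_k(y^k,\tilde z^k_1,\dots,\tilde z^k_{i-1},t,z^k_{i+1},\dots,z^k_p)+\mu_i\mathbb 1_{\{t\ne0\}}$. Put $\tilde z^k=(\tilde z^k_1,\dots,\tilde z^k_p)$, $T_k=\mathcal I(\tilde z^k)$, $\tilde w^k=[y^k;\tilde z^k]$. 2. (Semismooth Newton) Let $(D_k)$ be the problem of minimizing $\Xi_k(w)$ subject to $z_{\overline T_k}=0$, and $(P_k)$ the problem of minimizing $\Psi_k(x)=f_k(x)+g_k(Ax)+h_k(Bx)$, where $f_k(x)=\mathcal E_{\frac1{\gamma_k}f}(x-Q^\top w^k/\gamma_k)-\frac1{2\gamma_k}\|Q^\top w^k\|^2$, $g_k(u)=\mathcal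 E_{\frac1{\gamma_k}g}(u+y^k/\gamma_k)-\frac1{2\gamma_k}\|y^k\|^2$, $h_k(v)=\frac{\gamma_k}2\|(v+z^k/\gamma_k)_{T_k}\|^2-\frac1{2\gamma_k}\|z^k\|^2$. The duality gap is $G_k(x,w)=\Psi_k(x)+\Xi_k(w)$. Run SNA (below) and let $(x^{k+1},w^{k+1})=(\bar x^j,\bar w^j)$ for an index $j$ at which the prescribed stopping criteria hold. **Inner algorithm SNA.** Parameters $\tau\in(0,1]$, $\tau_1,\tau_2,\beta\in(0,1)$, $\zeta\in(0,1/2)$; start $\bar x^0=x^k$. For $j=0,1,\dots$: choose $H_j\in\widehat\partial^2\Psi_k(\bar x^j):=\partial^2f_k(\bar x^j)+A^\top\partial^2g_k(A\bar x^j)A+\gamma_kB_{T_k:}^\top B_{T_k:}$, where $\partial^2f_k,\partial^2g_k$ are the Clarke Jacobians of $\nabla f_k,\nabla g_k$; set $\theta_j=\tau_1\|\nabla\Psi_k(\bar x^j)\|$; compute by the conjugate gradient method an approximate solution $d^j$ of $(H_j+\theta_jI)d=-\nabla\Psi_k(\bar x^j)$ with residual norm at most $\tau_2\|\nabla\Psi_k(\bar x^j)\|^{1+\tau}$; set $\bar x^{j+1}=\bar x^j+\beta^{q_j}d^j$ with $q_j$ the smallest nonnegative integer $q$ such that $\Psi_k(\bar x^j+\beta^qd^j)\le\Psi_k(\bar x^j)+\zeta\beta^q\langle\nabla\Psi_k(\bar x^j),d^j\rangle$. The dual iterate is $\bar w^j=[\bar y^j;\bar z^j]$ with $\bar y^j=\mathrm{Prox}_{\gamma_kg^*}(\gamma_kA\bar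 x^j+y^k)$, $\bar z^j_{T_k}=z^k_{T_k}+\gamma_kB_{T_k:}\bar x^j$, $\bar z^j_{\overline T_k}=0$. In particular $w^{k+1}$ is obtained from $x^{k+1}$ by these formulas. *)

theory Defs
  imports "HOL-Analysis.Analysis"
begin

subsection \<open>Convex analysis for extended-real-valued functions\<close>

definition epi :: "('a \<Rightarrow> ereal) \<Rightarrow> ('a \<times> real) set"
  where "epi \<psi> = {(x, r). \<psi> x \<le> ereal r}"

definition edom :: "('a \<Rightarrow> ereal) \<Rightarrow> 'a set"
  where "edom \<psi> = {x. \<psi> x < \<infinity>}"

definition proper_closed_convex :: "('a::euclidean_space \<Rightarrow> ereal) \<Rightarrow> bool"
  where "proper_closed_convex \<psi> \<longleftrightarrow>
    (\<forall>x. \<psi> x \<noteq> -\<infinity>) \<and> edom \<psi> \<noteq> {} \<and> closed (epi \<psi>) \<and> convex (epi \<psi>)"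

definition polyhedral_fun :: "('a::euclidean_space \<Rightarrow> ereal) \<Rightarrow> bool"
  where "polyhedral_fun \<psi> \<longleftrightarrow> polyhedron (epi \<psi>)"

definition fenchel_conj :: "('a::real_inner \<Rightarrow> ereal) \<Rightarrow> 'a \<Rightarrow> ereal"
  where "fenchel_conj \<psi> y = (SUP x. ereal (y \<bullet> x) - \<psi> x)"

definition subdiff :: "('a::real_inner \<Rightarrow> ereal) \<Rightarrow> 'a \<Rightarrow> 'a set"
  where "subdiff \<psi> x =
    {v. \<bar>\<psi> x\<bar> \<noteq> \<infinity> \<and> (\<forall>u. \<psi> x + ereal (v \<bullet> (u - x)) \<le> \<psi> u)}"

definition regular_subdiff :: "('a::real_inner \<Rightarrow> ereal) \<Rightarrow> 'a \<Rightarrow> 'a set"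
  where "regular_subdiff \<psi> x =
    {v. \<bar>\<psi> x\<bar> \<noteq> \<infinity> \<and>
        0 \<le> Liminf (at x) (\<lambda>u. (\<psi> u - \<psi> x - ereal (v \<bullet> (u - x))) / ereal (norm (u - x)))}"

definition limiting_subdiff :: "('a::real_inner \<Rightarrow> ereal) \<Rightarrow> 'a \<Rightarrow> 'a set"
  where "limiting_subdiff \<psi> x =
    {v. \<bar>\<psi> x\<bar> \<noteq> \<infinity> \<and>
        (\<exists>xs vs. xs \<longlonglongrightarrow> x \<and> (\<lambda>j. \<psi> (xs j)) \<longlonglongrightarrow> \<psi> x \<and>
                 (\<forall>j. vs j \<in> regular_subdiff \<psi> (xs j)) \<and> vs \<longlonglongrightarrow> v)}"

definition local_minimizer :: "('a::topological_space \<Rightarrow> ereal) \<Rightarrow> 'a \<Rightarrow> bool"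
  where "local_minimizer \<psi> x \<longleftrightarrow> \<bar>\<psi> x\<bar> \<noteq> \<infinity> \<and> (\<forall>\<^sub>F u in nhds x. \<psi> x \<le> \<psi> u)"

definition prox_objective :: "real \<Rightarrow> ('a::real_inner \<Rightarrow> ereal) \<Rightarrow> 'a \<Rightarrow> 'a \<Rightarrow> ereal"
  where "prox_objective \<sigma> \<psi> p x = ereal ((norm (x - p))\<^sup>2 / (2 * \<sigma>)) + \<psi> x"

text \<open>For a proper closed convex function and \<open>\<sigma> > 0\<close> the infimum is finite and attained at
  exactly one point, so \<^const>\<open>real_of_ereal\<close> and the definite description below are meaningful.\<close>

definition moreau_env :: "real \<Rightarrow> ('a::real_inner \<Rightarrow> ereal) \<Rightarrow> 'a \<Rightarrow> real"
  where "moreau_env \<sigma> \<psi> p = real_of_ereal (INF x. prox_objective \<sigma> \<psi> p x)"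

definition prox :: "real \<Rightarrow> ('a::real_inner \<Rightarrow> ereal) \<Rightarrow> 'a \<Rightarrow> 'a"
  where "prox \<sigma> \<psi> p = (THE x. is_arg_min (prox_objective \<sigma> \<psi> p) (\<lambda>_. True) x)"

definition grad :: "('a::real_inner \<Rightarrow> real) \<Rightarrow> 'a \<Rightarrow> 'a"
  where "grad F x = (THE D. GDERIV F x :> D)"

definition clarke_jacobian :: "(real^'n \<Rightarrow> real^'m) \<Rightarrow> real^'n \<Rightarrow> (real^'n^'m) set"
  where "clarke_jacobian F x = convex hull
    {V. \<exists>xs. xs \<longlonglongrightarrow> x \<and> (\<forall>j. F differentiable (at (xs j))) \<and>
             (\<lambda>j. jacobian F (at (xs j))) \<longlonglongrightarrow> V}"


subsection \<open>The weighted zero norm\<close>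

definition supp :: "real^'p \<Rightarrow> 'p set"
  where "supp z = {i. z $ i \<noteq> 0}"

definition zero_norm :: "real^'p \<Rightarrow> real^'p \<Rightarrow> real"
  where "zero_norm lam u = (\<Sum>i\<in>UNIV. if u $ i \<noteq> 0 then lam $ i else 0)"

lemma zero_norm_regular:
  fixes lam z v :: "real^'p"
  assumes pos: "\<forall>i. lam $ i > 0" and v: "\<forall>i. z $ i \<noteq> 0 \<longrightarrow> v $ i = 0"
  shows "v \<in> regular_subdiff (\<lambda>u. ereal (zero_norm lam u)) z"
proof -
  have ev: "\<forall>\<^sub>F u in nhds z. v $ i * (u $ i - z $ i)
      \<le> (if u $ i \<noteq> 0 then lam $ i else 0) - (if z $ i \<noteq> 0 then lam $ i else 0)" for i
  proof -
    have t: "((\<lambda>u. u $ i) \<longlongrightarrow> z $ i) (nhds z)"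
      by (rule tendsto_vec_nth) (rule filterlim_ident)
    show ?thesis
    proof (cases "z $ i = 0")
      case True
      have "((\<lambda>u. v $ i * (u $ i - z $ i)) \<longlongrightarrow> v $ i * (z $ i - z $ i)) (nhds z)"
        by (intro tendsto_intros t)
      then have "((\<lambda>u. v $ i * (u $ i - z $ i)) \<longlongrightarrow> 0) (nhds z)" by simp
      then have "\<forall>\<^sub>F u in nhds z. v $ i * (u $ i - z $ i) < lam $ i"
        using order_tendstoD(2) pos by blast
      then show ?thesis by eventually_elim (use True in auto)
    next
      case False
      have "\<forall>\<^sub>F u in nhds z. u $ i \<noteq> 0" using tendsto_imp_eventually_ne[OF t False] .
      then show ?thesis by eventually_elim (use v False in auto)
    qed
  qed
  have "\<forall>\<^sub>F u in nhds z. \<forall>i. v $ i * (u $ i - z $ i)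
      \<le> (if u $ i \<noteq> 0 then lam $ i else 0) - (if z $ i \<noteq> 0 then lam $ i else 0)"
    using ev by (simp add: eventually_all_finite)
  then have "\<forall>\<^sub>F u in nhds z. v \<bullet> (u - z) \<le> zero_norm lam u - zero_norm lam z"
  proof eventually_elim
    case (elim u)
    have "v \<bullet> (u - z) = (\<Sum>i\<in>UNIV. v $ i * (u $ i - z $ i))"
      by (simp add: inner_vec_def)
    also have "\<dots> \<le> (\<Sum>i\<in>UNIV. (if u $ i \<noteq> 0 then lam $ i else 0) - (if z $ i \<noteq> 0 then lam $ i else 0))"
      by (rule sum_mono) (use elim in blast)
    also have "\<dots> = zero_norm lam u - zero_norm lam z"
      unfolding zero_norm_def by (rule sum_subtractf)
    finally show ?case .
  qed
  then have "\<forall>\<^sub>F u in at z. 0 \<le> (ereal (zero_norm lam u) - ereal (zero_norm lam z) - ereal (v \<bullet> (u - z)))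
      / ereal (norm (u - z))"
    unfolding eventually_at_filter
  proof (eventually_elim, intro impI)
    fix u assume *: "v \<bullet> (u - z) \<le> zero_norm lam u - zero_norm lam z" "u \<noteq> z"
    then show "0 \<le> (ereal (zero_norm lam u) - ereal (zero_norm lam z) - ereal (v \<bullet> (u - z)))
      / ereal (norm (u - z))" by simp
  qed
  then show ?thesis unfolding regular_subdiff_def by (auto intro: Liminf_bounded)
qed

lemma zero_norm_regularD:
  fixes lam z v :: "real^'p"
  assumes v: "v \<in> regular_subdiff (\<lambda>u. ereal (zero_norm lam u)) z" and i: "z $ i \<noteq> 0"
  shows "v $ i = 0"
proof -
  let ?q = "\<lambda>u. (ereal (zero_norm lam u) - ereal (zero_norm lam z) - ereal (v \<bullet> (u - z)))
      / ereal (norm (u - z))"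
  have L: "0 \<le> Liminf (at z) ?q" using v by (simp add: regular_subdiff_def)
  have *: "s * v $ i \<le> 0" if s: "\<bar>s\<bar> = 1" for s :: real
  proof (rule ccontr)
    assume "\<not> s * v $ i \<le> 0"
    then have p: "s * v $ i > 0" by simp
    have "ereal (- (s * v $ i)) < Liminf (at z) ?q"
      by (rule less_le_trans[OF _ L]) (use p in simp)
    then have e: "\<forall>\<^sub>F u in at z. ereal (- (s * v $ i)) < ?q u" by (rule less_LiminfD)
    have f: "filterlim (\<lambda>t::real. z + (t * s) *\<^sub>R axis i 1) (at z) (at_right 0)"
    proof (rule filterlim_atI)
      have "((\<lambda>t::real. z + (t * s) *\<^sub>R axis i 1) \<longlongrightarrow> z + (0 * s) *\<^sub>R axis i (1::real)) (at_right 0)"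
        by (intro tendsto_intros)
      then show "((\<lambda>t::real. z + (t * s) *\<^sub>R axis i 1) \<longlongrightarrow> z) (at_right 0)" by simp
      show "\<forall>\<^sub>F t in at_right 0. z + (t * s) *\<^sub>R axis i 1 \<noteq> z"
        using eventually_at_right_less[of "0::real"]
        by eventually_elim (use s in \<open>auto simp: axis_eq_0_iff\<close>)
    qed
    have e1: "\<forall>\<^sub>F t in at_right 0. ereal (- (s * v $ i)) < ?q (z + (t * s) *\<^sub>R axis i 1)"
      by (rule eventually_compose_filterlim[OF e f])
    have e2: "\<forall>\<^sub>F t::real in at_right 0. 0 < t \<and> t < \<bar>z $ i\<bar>"
      using eventually_at_right_real[of 0 "\<bar>z $ i\<bar>"] i by simp
    obtain t where t: "0 < t" "t < \<bar>z $ i\<bar>" 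
        and lt: "ereal (- (s * v $ i)) < ?q (z + (t * s) *\<^sub>R axis i 1)"
      using eventually_happens'[OF _ eventually_conj[OF e1 e2]] by auto
    have "\<bar>t * s\<bar> < \<bar>z $ i\<bar>" using t s by (simp add: abs_mult)
    then have nz: "z $ i + t * s \<noteq> 0" by linarith
    have "zero_norm lam (z + (t * s) *\<^sub>R axis i 1) = zero_norm lam z"
      unfolding zero_norm_def using nz i by (intro sum.cong) (auto simp: axis_def)
    moreover have "v \<bullet> ((t * s) *\<^sub>R axis i 1) = t * s * v $ i" by (simp add: inner_axis)
    moreover have "norm ((t * s) *\<^sub>R axis i (1::real)) = t" using s t by (simp add: abs_mult)
    ultimately show False using lt t s by (auto simp: mult.assoc inner_axis)
  qed
  have "v $ i \<le> 0" "- v $ i \<le> 0" using *[of 1] *[of "-1"] by simp_all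
  then show ?thesis by linarith
qed

lemma limiting_subdiff_zero_norm:
  fixes lam z :: "real^'p"
  assumes "\<forall>i. lam $ i > 0"
  shows "limiting_subdiff (\<lambda>u. ereal (zero_norm lam u)) z = {v. \<forall>i. z $ i \<noteq> 0 \<longrightarrow> v $ i = 0}"
proof (intro set_eqI iffI)
  fix v :: "real^'p" assume "v \<in> limiting_subdiff (\<lambda>u. ereal (zero_norm lam u)) z"
  then obtain xs vs where xs: "xs \<longlonglongrightarrow> z" and vs: "vs \<longlonglongrightarrow> v"
    and r: "\<And>j. vs j \<in> regular_subdiff (\<lambda>u. ereal (zero_norm lam u)) (xs j)"
    by (auto simp: limiting_subdiff_def)
  have "v $ i = 0" if "z $ i \<noteq> 0" for i
  proof -
    have "(\<lambda>j. xs j $ i) \<longlonglongrightarrow> z $ i" by (rule tendsto_vec_nth[OF xs])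
    then have "\<forall>\<^sub>F j in sequentially. xs j $ i \<noteq> 0"
      by (rule tendsto_imp_eventually_ne) (rule that)
    then have "\<forall>\<^sub>F j in sequentially. vs j $ i = 0"
      by (rule eventually_mono) (rule zero_norm_regularD[OF r])
    then have "(\<lambda>j. vs j $ i) \<longlonglongrightarrow> 0" by (rule tendsto_eventually)
    then show ?thesis by (rule LIMSEQ_unique[OF tendsto_vec_nth[OF vs]])
  qed
  then show "v \<in> {v. \<forall>i. z $ i \<noteq> 0 \<longrightarrow> v $ i = 0}" by simp
next
  fix v :: "real^'p" assume "v \<in> {v. \<forall>i. z $ i \<noteq> 0 \<longrightarrow> v $ i = 0}"
  then have "v \<in> regular_subdiff (\<lambda>u. ereal (zero_norm lam u)) z"
    using zero_norm_regular assms by blast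
  then show "v \<in> limiting_subdiff (\<lambda>u. ereal (zero_norm lam u)) z"
    unfolding limiting_subdiff_def mem_Collect_eq
    by (intro conjI exI[of _ "\<lambda>_. z"] exI[of _ "\<lambda>_. v"] allI tendsto_const) simp_all
qed

text \<open>Subvectors and row submatrices indexed by \<open>T\<close> are kept in the ambient space, with zeros
  at the positions outside \<open>T\<close>; this changes neither norms nor the products
  \<open>B\<^sub>T\<^sup>T B\<^sub>T\<close>.  The type \<open>'b\<close> is \<^typ>\<open>real\<close> for vectors and
  \<^typ>\<open>real^'n\<close> for matrices.\<close>

definition restrict_rows :: "'p set \<Rightarrow> ('b::zero)^'p \<Rightarrow> 'b^'p"
  where "restrict_rows T u = (\<chi> i. if i \<in> T then u $ i else 0)"


subsection \<open>The primal and dual problems\<close>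

text \<open>A dual vector \<open>w = [y; z]\<close> is the pair \<open>(y, z)\<close>; the norm and the inner
  product of the product type are the Euclidean ones.\<close>

definition Q_map :: "real^'n^'m \<Rightarrow> real^'n^'p \<Rightarrow> real^'n \<Rightarrow> (real^'m) \<times> (real^'p)"
  where "Q_map A B x = (A *v x, B *v x)"

definition Q_adj :: "real^'n^'m \<Rightarrow> real^'n^'p \<Rightarrow> (real^'m) \<times> (real^'p) \<Rightarrow> real^'n"
  where "Q_adj A B w = transpose A *v fst w + transpose B *v snd w"

definition M_map :: "real^'n^'m \<Rightarrow> real^'n^'p \<Rightarrow> (real^'m) \<times> (real^'p) \<Rightarrow> (real^'m) \<times> (real^'p)"
  where "M_map A B w = Q_map A B (Q_adj A B w) + w"

definition M_norm_sq :: "real^'n^'m \<Rightarrow> real^'n^'p \<Rightarrow> (real^'m) \<times> (real^'p) \<Rightarrow> real"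
  where "M_norm_sq A B w = w \<bullet> M_map A B w"

definition Xi :: "(real^'n \<Rightarrow> ereal) \<Rightarrow> (real^'m \<Rightarrow> ereal) \<Rightarrow> real^'n^'m \<Rightarrow> real^'n^'p
    \<Rightarrow> (real^'m) \<times> (real^'p) \<Rightarrow> ereal"
  where "Xi f g A B w = fenchel_conj f (- Q_adj A B w) + fenchel_conj g (fst w)"

definition primal_obj :: "(real^'n \<Rightarrow> ereal) \<Rightarrow> (real^'m \<Rightarrow> ereal) \<Rightarrow> real^'n^'m \<Rightarrow> real^'n^'p
    \<Rightarrow> real^'p \<Rightarrow> real^'n \<Rightarrow> ereal"
  where "primal_obj f g A B lam x = f x + g (A *v x) + ereal (zero_norm lam (B *v x))"

definition dual_obj :: "(real^'n \<Rightarrow> ereal) \<Rightarrow> (real^'m \<Rightarrow> ereal) \<Rightarrow> real^'n^'m \<Rightarrow> real^'n^'p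
    \<Rightarrow> real^'p \<Rightarrow> (real^'m) \<times> (real^'p) \<Rightarrow> ereal"
  where "dual_obj f g A B mu w = Xi f g A B w + ereal (zero_norm mu (snd w))"

definition stationary_primal :: "(real^'n \<Rightarrow> ereal) \<Rightarrow> (real^'m \<Rightarrow> ereal) \<Rightarrow> real^'n^'m \<Rightarrow> real^'n^'p
    \<Rightarrow> real^'p \<Rightarrow> real^'n \<Rightarrow> bool"
  where "stationary_primal f g A B lam x \<longleftrightarrow>
    (\<exists>a \<in> subdiff f x. \<exists>b \<in> subdiff g (A *v x).
       \<exists>c \<in> limiting_subdiff (\<lambda>u. ereal (zero_norm lam u)) (B *v x).
         a + transpose A *v b + transpose B *v c = 0)"

definition stationary_dual :: "(real^'n \<Rightarrow> ereal) \<Rightarrow> (real^'m \<Rightarrow> ereal) \<Rightarrow> real^'n^'m \<Rightarrow> real^'n^'p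
    \<Rightarrow> real^'p \<Rightarrow> (real^'m) \<times> (real^'p) \<Rightarrow> bool"
  where "stationary_dual f g A B mu w \<longleftrightarrow>
    (\<exists>\<xi> \<in> subdiff (fenchel_conj f) (- Q_adj A B w).
       A *v \<xi> \<in> subdiff (fenchel_conj g) (fst w) \<and>
       B *v \<xi> \<in> limiting_subdiff (\<lambda>u. ereal (zero_norm mu u)) (snd w))"


subsection \<open>Subproblems\<close>

text \<open>Below, \<open>c\<close> is the current proximal parameter \<open>\<gamma>\<^sub>k\<close> and \<open>wk\<close> the
  current dual iterate \<open>w\<^sup>k\<close>.\<close>

definition Xi_prox :: "(real^'n \<Rightarrow> ereal) \<Rightarrow> (real^'m \<Rightarrow> ereal) \<Rightarrow> real^'n^'m \<Rightarrow> real^'n^'p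
    \<Rightarrow> real \<Rightarrow> (real^'m) \<times> (real^'p) \<Rightarrow> (real^'m) \<times> (real^'p) \<Rightarrow> ereal"
  where "Xi_prox f g A B c wk w = Xi f g A B w + ereal (M_norm_sq A B (w - wk) / (2 * c))"

definition f_sub :: "(real^'n \<Rightarrow> ereal) \<Rightarrow> real^'n^'m \<Rightarrow> real^'n^'p
    \<Rightarrow> real \<Rightarrow> (real^'m) \<times> (real^'p) \<Rightarrow> real^'n \<Rightarrow> real"
  where "f_sub f A B c wk x =
    moreau_env (1 / c) f (x - (1 / c) *\<^sub>R Q_adj A B wk) - (norm (Q_adj A B wk))\<^sup>2 / (2 * c)"

definition g_sub :: "(real^'m \<Rightarrow> ereal) \<Rightarrow> real \<Rightarrow> (real^'m) \<times> (real^'p) \<Rightarrow> real^'m \<Rightarrow> real"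
  where "g_sub g c wk u =
    moreau_env (1 / c) g (u + (1 / c) *\<^sub>R fst wk) - (norm (fst wk))\<^sup>2 / (2 * c)"

definition h_sub :: "real \<Rightarrow> (real^'m) \<times> (real^'p) \<Rightarrow> 'p set \<Rightarrow> real^'p \<Rightarrow> real"
  where "h_sub c wk T v =
    c / 2 * (norm (restrict_rows T (v + (1 / c) *\<^sub>R snd wk)))\<^sup>2 - (norm (snd wk))\<^sup>2 / (2 * c)"

definition Psi :: "(real^'n \<Rightarrow> ereal) \<Rightarrow> (real^'m \<Rightarrow> ereal) \<Rightarrow> real^'n^'m \<Rightarrow> real^'n^'p
    \<Rightarrow> real \<Rightarrow> (real^'m) \<times> (real^'p) \<Rightarrow> 'p set \<Rightarrow> real^'n \<Rightarrow> real"
  where "Psi f g A B c wk T x =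
    f_sub f A B c wk x + g_sub g c wk (A *v x) + h_sub c wk T (B *v x)"

definition duality_gap :: "(real^'n \<Rightarrow> ereal) \<Rightarrow> (real^'m \<Rightarrow> ereal) \<Rightarrow> real^'n^'m \<Rightarrow> real^'n^'p
    \<Rightarrow> real \<Rightarrow> (real^'m) \<times> (real^'p) \<Rightarrow> 'p set \<Rightarrow> real^'n \<Rightarrow> (real^'m) \<times> (real^'p) \<Rightarrow> ereal"
  where "duality_gap f g A B c wk T x w =
    ereal (Psi f g A B c wk T x) + Xi_prox f g A B c wk w"

definition Psi_hessians :: "(real^'n \<Rightarrow> ereal) \<Rightarrow> (real^'m \<Rightarrow> ereal) \<Rightarrow> real^'n^'m \<Rightarrow> real^'n^'p
    \<Rightarrow> real \<Rightarrow> (real^'m) \<times> (real^'p) \<Rightarrow> 'p set \<Rightarrow> real^'n \<Rightarrow> (real^'n^'n) set"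
  where "Psi_hessians f g A B c wk T x =
    {H1 + transpose A ** H2 ** A + c *\<^sub>R (transpose (restrict_rows T B) ** restrict_rows T B)
     | H1 H2. H1 \<in> clarke_jacobian (grad (f_sub f A B c wk)) x \<and>
              H2 \<in> clarke_jacobian (grad (g_sub g c wk)) (A *v x)}"


subsection \<open>The inner algorithm\<close>

definition armijo :: "real \<Rightarrow> real \<Rightarrow> (real^'n \<Rightarrow> real) \<Rightarrow> real^'n \<Rightarrow> real^'n \<Rightarrow> nat \<Rightarrow> bool"
  where "armijo \<beta> \<zeta> F x d q \<longleftrightarrow>
    F (x + \<beta> ^ q *\<^sub>R d) \<le> F x + \<zeta> * \<beta> ^ q * (grad F x \<bullet> d)"

text \<open>One iteration for minimizing \<open>F\<close> with generalized Hessians \<open>\<H> x\<close>.  The conjugate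
  gradient method enters through its termination test only: its starting vector is not prescribed,
  so every \<open>d\<close> meeting the residual bound is a possible output (of zero inner iterations).\<close>

definition sna_step :: "real \<Rightarrow> real \<Rightarrow> real \<Rightarrow> real \<Rightarrow> real \<Rightarrow> (real^'n \<Rightarrow> real)
    \<Rightarrow> (real^'n \<Rightarrow> (real^'n^'n) set) \<Rightarrow> real^'n \<Rightarrow> real^'n \<Rightarrow> bool"
  where "sna_step \<tau> \<tau>1 \<tau>2 \<beta> \<zeta> F \<H> x x' \<longleftrightarrow>
    (\<exists>H \<in> \<H> x. \<exists>d q.
       norm ((H + (\<tau>1 * norm (grad F x)) *\<^sub>R mat 1) *v d + grad F x)
         \<le> \<tau>2 * norm (grad F x) powr (1 + \<tau>) \<and>
       armijo \<beta> \<zeta> F x d q \<and> (\<forall>q'<q. \<not> armijo \<beta> \<zeta> F x d q') \<and>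
       x' = x + \<beta> ^ q *\<^sub>R d)"

definition dual_iterate :: "(real^'m \<Rightarrow> ereal) \<Rightarrow> real^'n^'m \<Rightarrow> real^'n^'p
    \<Rightarrow> real \<Rightarrow> (real^'m) \<times> (real^'p) \<Rightarrow> 'p set \<Rightarrow> real^'n \<Rightarrow> (real^'m) \<times> (real^'p)"
  where "dual_iterate g A B c wk T x =
    (prox c (fenchel_conj g) (c *\<^sub>R (A *v x) + fst wk),
     restrict_rows T (snd wk + c *\<^sub>R (B *v x)))"


subsection \<open>The outer algorithm\<close>

text \<open>The linear order on the finite index type \<open>'p\<close> is the order in which the coordinates
  are processed; \<open>gs_vec zt z i t\<close> is the point \<open>(zt\<^sub>1, \<dots>, zt\<^sub>i\<^sub>-\<^sub>1, t, z\<^sub>i\<^sub>+\<^sub>1, \<dots>, z\<^sub>p)\<close>.\<close>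

definition gs_vec :: "(real, 'p::{finite,linorder}) vec \<Rightarrow> (real, 'p) vec \<Rightarrow> 'p \<Rightarrow> real
    \<Rightarrow> (real, 'p) vec"
  where "gs_vec zt z i t = (\<chi> j. if j < i then zt $ j else if j = i then t else z $ j)"

definition coord_min :: "(real^'n \<Rightarrow> ereal) \<Rightarrow> (real^'m \<Rightarrow> ereal) \<Rightarrow> real^'n^'m
    \<Rightarrow> (real^'n, 'p::{finite,linorder}) vec \<Rightarrow> (real, 'p) vec
    \<Rightarrow> real \<Rightarrow> (real^'m) \<times> (real, 'p) vec \<Rightarrow> (real, 'p) vec \<Rightarrow> bool"
  where "coord_min f g A B mu c wk zt \<longleftrightarrow>
    (\<forall>i. is_arg_min
           (\<lambda>t. Xi_prox f g A B c wk (fst wk, gs_vec zt (snd wk) i t)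
                + ereal (if t \<noteq> 0 then mu $ i else 0))
           (\<lambda>_. True) (zt $ i))"

text \<open>The sequences \<open>x\<close>, \<open>w\<close> are generated by the algorithm, with \<open>zt k\<close> the
  outcome of the coordinate minimization in iteration \<open>k\<close> and \<open>xb 0, \<dots>, xb J\<close> the inner
  iterates; the criteria for stopping at \<open>J\<close> are left open here.\<close>

definition ppsna :: "(real^'n \<Rightarrow> ereal) \<Rightarrow> (real^'m \<Rightarrow> ereal) \<Rightarrow> real^'n^'m
    \<Rightarrow> (real^'n, 'p::{finite,linorder}) vec \<Rightarrow> (real, 'p) vec
    \<Rightarrow> real \<Rightarrow> real \<Rightarrow> real \<Rightarrow> real \<Rightarrow> real \<Rightarrow> (nat \<Rightarrow> real)
    \<Rightarrow> (nat \<Rightarrow> real^'n) \<Rightarrow> (nat \<Rightarrow> (real^'m) \<times> (real, 'p) vec) \<Rightarrow> (nat \<Rightarrow> (real, 'p) vec) \<Rightarrow> bool"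
  where "ppsna f g A B mu \<tau> \<tau>1 \<tau>2 \<beta> \<zeta> \<gamma> x w zt \<longleftrightarrow>
    fst (w 0) \<in> edom (fenchel_conj g) \<and>
    \<gamma> 0 > 0 \<and> incseq \<gamma> \<and> convergent \<gamma> \<and>
    0 < \<tau> \<and> \<tau> \<le> 1 \<and> 0 < \<tau>1 \<and> \<tau>1 < 1 \<and> 0 < \<tau>2 \<and> \<tau>2 < 1 \<and>
    0 < \<beta> \<and> \<beta> < 1 \<and> 0 < \<zeta> \<and> \<zeta> < 1 / 2 \<and>
    (\<forall>k. coord_min f g A B mu (\<gamma> k) (w k) (zt k) \<and>
         (\<exists>xb J. xb 0 = x k \<and>
            (\<forall>j<J. sna_step \<tau> \<tau>1 \<tau>2 \<beta> \<zeta>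
                     (Psi f g A B (\<gamma> k) (w k) (supp (zt k)))
                     (Psi_hessians f g A B (\<gamma> k) (w k) (supp (zt k)))
                     (xb j) (xb (Suc j))) \<and>
            x (Suc k) = xb J) \<and>
         w (Suc k) = dual_iterate g A B (\<gamma> k) (w k) (supp (zt k)) (x (Suc k)))"

text \<open>The common value of \<open>supp (zt k)\<close> for all large \<open>k\<close>; it is an arbitrary set if there
  is no such value.\<close>

definition eventual_supp :: "(nat \<Rightarrow> real^'p) \<Rightarrow> 'p set"
  where "eventual_supp zt = (THE T. \<forall>\<^sub>F k in sequentially. supp (zt k) = T)"

definition ri_or_dom :: "('a::euclidean_space \<Rightarrow> ereal) \<Rightarrow> 'a set"
  where "ri_or_dom \<psi> = (if polyhedral_fun \<psi> then edom \<psi> else rel_interior (edom \<psi>))"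

end

theory Submission
  imports Defs
begin

text \<open>
  The dual objective decreases along the outer iteration, so its decrease and the steps
  \<open>w\<^sup>k\<^sup>+\<^sup>1 - w\<^sup>k\<close> tend to zero. As \<open>f\<^sup>*\<close> is finite and Lipschitz on
  bounded sets, coordinate minimization would gain a fixed amount from a small nonzero
  coordinate; hence the nonzero \<open>z\<^sup>k\<^sub>i\<close> stay away from zero and the supports
  become constant. From then on (C2) makes the duality gap, which is a sum of Fenchel gaps and
  squares, summably small. Cluster points therefore satisfy the Fenchel equalities for both
  problems, which are the two stationarity conditions, and monotonicity of the
  \<open>\<epsilon>\<close>-subdifferentials makes \<open>\<parallel>w\<^sup>k - w\<parallel>\<^sub>M\<^sup>2\<close> quasi-Fejer monotone,
  so the whole sequence converges. Stationary points are local minimizers because the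
  zero norm is locally minorized by any linear function vanishing on the support.
\<close>

subsection \<open>Fenchel conjugates\<close>

text \<open>Once the supports stay equal to a fixed S, the method is an inexact proximal point
  iteration for the convex problem of minimizing Xi over the z that vanish off S; the zero norm is
  constant along the iterates. The obstacle is that a subproblem is solved only up to a duality gap,
  and the gap is written with Moreau envelopes. It therefore yields approximate subgradients not at
  x^{k+1} and A x^{k+1} but at nearby points \<open>xp\<close> and \<open>up\<close>. With d =
  w^{k+1} - w^k these points differ from x^{k+1} and A x^{k+1} by Q^T d / gamma_k and - d_y /
  gamma_k up to \<open>tol k\<close>, while (B x^{k+1})_S = d_z / gamma_k. Steps tending to zero
  thus remove the shift in the limit. The same three formulas explain the metric. Paired with a =
  w^{k+1} - w, where w is the reference solution, the f part yields <Q^T a, Q^T d>, and the g and z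
  parts together yield <a, d>. The sum is <a, M d>, which turns monotonicity into decrease of the
  M-norm. The error is linear in \<open>tol k\<close>, and this is where summability of epsilon_k
  enters.\<close>

lemma fenchel_conj_upper: "ereal (y \<bullet> x) - \<psi> x \<le> fenchel_conj \<psi> y"
  unfolding fenchel_conj_def by (rule SUP_upper) simp

locale proper_function =
  fixes \<psi> :: "'a::euclidean_space \<Rightarrow> ereal"
  assumes not_MInf: "\<psi> x \<noteq> -\<infinity>"
    and edom_nonempty: "edom \<psi> \<noteq> {}"
begin

lemma obtain_finite: obtains x0 r0 where "\<psi> x0 = ereal r0"
proof -
  obtain x0 where "\<psi> x0 < \<infinity>" using edom_nonempty by (auto simp: edom_def)
  then show thesis using that[of x0] not_MInf[of x0] by (cases "\<psi> x0") auto
qed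

lemma conj_not_MInf: "fenchel_conj \<psi> y \<noteq> -\<infinity>"
proof -
  obtain x0 r0 where "\<psi> x0 = ereal r0" by (rule obtain_finite)
  then show ?thesis using fenchel_conj_upper[of y x0 \<psi>] by auto
qed

lemma fenchel_young: "ereal (y \<bullet> x) \<le> \<psi> x + fenchel_conj \<psi> y"
  using fenchel_conj_upper[of y x \<psi>] not_MInf[of x] conj_not_MInf[of y]
  by (cases "\<psi> x"; cases "fenchel_conj \<psi> y") auto

lemma fenchel_equality_finite:
  assumes "\<psi> x + fenchel_conj \<psi> y \<le> ereal c"
  obtains a b where "\<psi> x = ereal a" "fenchel_conj \<psi> y = ereal b"
  using assms not_MInf[of x] conj_not_MInf[of y] that
  by (cases "\<psi> x"; cases "fenchel_conj \<psi> y") auto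

text \<open>Subtracting the Fenchel-Young inequality at \<open>(y, u)\<close>, respectively at
  \<open>(v, x)\<close>, gives the two inclusions, so the second one needs no biconjugate.\<close>

lemma fenchel_equality_subdiff:
  assumes "\<psi> x + fenchel_conj \<psi> y \<le> ereal (y \<bullet> x)"
  shows "y \<in> subdiff \<psi> x" "x \<in> subdiff (fenchel_conj \<psi>) y"
proof -
  obtain a b where ab: "\<psi> x = ereal a" "fenchel_conj \<psi> y = ereal b"
    using fenchel_equality_finite[OF assms] by blast
  have le: "a + b \<le> y \<bullet> x" using assms ab by simp
  have "\<psi> x + ereal (y \<bullet> (u - x)) \<le> \<psi> u" for u
    using fenchel_young[of y u] le ab not_MInf[of u]
    by (cases "\<psi> u") (auto simp: inner_diff_right)
  then show "y \<in> subdiff \<psi> x" using ab by (simp add: subdiff_def)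
  have "fenchel_conj \<psi> y + ereal (x \<bullet> (v - y)) \<le> fenchel_conj \<psi> v" for v
    using fenchel_young[of v x] le ab conj_not_MInf[of v]
    by (cases "fenchel_conj \<psi> v") (auto simp: inner_diff_right inner_commute)
  then show "x \<in> subdiff (fenchel_conj \<psi>) y" using ab by (simp add: subdiff_def)
qed

text \<open>Adding the Fenchel-Young inequalities at the crossed pairs \<open>(y, x')\<close> and
  \<open>(y', x)\<close> to the two hypotheses cancels all function values.\<close>

lemma fenchel_gap_monotone:
  assumes eq: "\<psi> x + fenchel_conj \<psi> y \<le> ereal (y \<bullet> x)"
    and gap: "\<psi> x' + fenchel_conj \<psi> y' \<le> ereal (y' \<bullet> x' + e)"
  shows "- e \<le> (y' - y) \<bullet> (x' - x)"
proof -
  obtain a b where ab: "\<psi> x = ereal a" "fenchel_conj \<psi> y = ereal b"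
    using fenchel_equality_finite[OF eq] by blast
  obtain a' b' where ab': "\<psi> x' = ereal a'" "fenchel_conj \<psi> y' = ereal b'"
    using fenchel_equality_finite[OF gap] by blast
  show ?thesis
    using fenchel_young[of y x'] fenchel_young[of y' x] eq gap ab ab'
    by (simp add: inner_diff_left inner_diff_right)
qed

end

lemma epi_closed_limit:
  assumes "closed (epi \<psi>)" "xs \<longlonglongrightarrow> x" "cs \<longlonglongrightarrow> c" "\<And>n. \<psi> (xs n) \<le> ereal (cs n)"
  shows "\<psi> x \<le> ereal c"
proof -
  have "(\<lambda>n. (xs n, cs n)) \<longlonglongrightarrow> (x, c)" by (intro tendsto_Pair assms)
  then have "(x, c) \<in> epi \<psi>"
    by (rule closed_sequentially[OF assms(1), rotated]) (simp add: epi_def assms(4))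
  then show ?thesis by (simp add: epi_def)
qed

locale proper_closed_function = proper_function +
  assumes closed_epi: "closed (epi \<psi>)"
begin

text \<open>Each fixed \<open>u\<close> of finite value bounds the conjugate below, hence bounds
  \<open>\<psi> (xs n)\<close> above by a convergent sequence. The closed epigraph passes this bound
  to the limit, and the supremum over \<open>u\<close> rebuilds the conjugate at
  \<open>y\<close>.\<close>

lemma fenchel_gap_limit:
  assumes xs: "xs \<longlonglongrightarrow> x" and ys: "ys \<longlonglongrightarrow> y" and es: "es \<longlonglongrightarrow> 0"
    and gap: "\<And>n. \<psi> (xs n) + fenchel_conj \<psi> (ys n) \<le> ereal (ys n \<bullet> xs n + es n)"
  shows "\<psi> x + fenchel_conj \<psi> y \<le> ereal (y \<bullet> x)"
proof -
  have fin: "\<psi> x \<le> ereal (y \<bullet> x - y \<bullet> u + r)" if u: "\<psi> u = ereal r" for u r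
  proof (rule epi_closed_limit[OF closed_epi xs])
    have "(\<lambda>n. ys n \<bullet> xs n + es n - ys n \<bullet> u + r) \<longlonglongrightarrow> y \<bullet> x + 0 - y \<bullet> u + r"
      by (intro tendsto_intros xs ys es)
    then show "(\<lambda>n. ys n \<bullet> xs n + es n - ys n \<bullet> u + r) \<longlonglongrightarrow> y \<bullet> x - y \<bullet> u + r" by simp
    show "\<psi> (xs n) \<le> ereal (ys n \<bullet> xs n + es n - ys n \<bullet> u + r)" for n
    proof -
      obtain a b where "\<psi> (xs n) = ereal a" "fenchel_conj \<psi> (ys n) = ereal b"
        using fenchel_equality_finite[OF gap] by blast
      then show ?thesis using gap[of n] fenchel_young[of "ys n" u] u by simp
    qed
  qed
  obtain x0 r0 where "\<psi> x0 = ereal r0" by (rule obtain_finite)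
  from fin[OF this] not_MInf[of x] obtain a where a: "\<psi> x = ereal a" by (cases "\<psi> x") auto
  have "fenchel_conj \<psi> y \<le> ereal (y \<bullet> x - a)"
    unfolding fenchel_conj_def
  proof (rule SUP_least)
    fix u
    show "ereal (y \<bullet> u) - \<psi> u \<le> ereal (y \<bullet> x - a)"
      using fin[of u] not_MInf[of u] a by (cases "\<psi> u") auto
  qed
  then show ?thesis using a by (cases "fenchel_conj \<psi> y") auto
qed

text \<open>Values tending to minus infinity along a sequence in \<open>C\<close> would force the
  value minus infinity at a cluster point.\<close>

lemma bounded_below_on_compact:
  assumes "compact C"
  obtains m where "\<And>x. x \<in> C \<Longrightarrow> ereal m \<le> \<psi> x"
proof (rule ccontr)
  assume "\<not> thesis"
  then have "\<forall>n. \<exists>x \<in> C. \<psi> x < ereal (- real n)"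
    using that by (metis not_le)
  then obtain xs where xs: "\<And>n. xs n \<in> C" "\<And>n. \<psi> (xs n) < ereal (- real n)" by metis
  then obtain l r where l: "strict_mono (r :: nat \<Rightarrow> nat)" "(xs \<circ> r) \<longlonglongrightarrow> l"
    using assms unfolding compact_def by metis
  have "\<psi> l \<le> ereal (- real m)" for m
  proof (rule epi_closed_limit[OF closed_epi LIMSEQ_ignore_initial_segment[OF l(2), of m]])
    show "(\<lambda>n. - real m) \<longlonglongrightarrow> - real m" by simp
    fix n
    have "m \<le> r (n + m)" using seq_suble[OF l(1), of "n + m"] by simp
    then have "ereal (- real (r (n + m))) \<le> ereal (- real m)" by simp
    then show "\<psi> ((xs \<circ> r) (n + m)) \<le> ereal (- real m)"
      using xs(2)[of "r (n + m)"] by (metis comp_apply less_imp_le order_trans)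
  qed
  then have "\<psi> l \<le> ereal r" for r
    using reals_Archimedean2[of "- r"] by (metis ereal_less_eq(3) less_imp_le minus_le_iff order_trans)
  then show False using not_MInf[of l] ereal_bot by blast
qed

end

lemma proper_closed_convex_function:
  "proper_closed_convex \<psi> \<Longrightarrow> proper_closed_function \<psi>"
  by unfold_locales (auto simp: proper_closed_convex_def)

subsection \<open>Superlinear functions\<close>

locale superlinear_function = proper_closed_function +
  assumes superlinear: "Liminf at_infinity (\<lambda>u. \<psi> u / ereal (norm u)) = \<infinity>"
begin

lemma linear_lower_bound:
  obtains C where "\<And>u. ereal (K * norm u - C) \<le> \<psi> u"
proof -
  have "\<forall>\<^sub>F u in at_infinity. ereal K < \<psi> u / ereal (norm u)"
    by (rule less_LiminfD) (simp add: superlinear)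
  then obtain R where R: "\<And>u. R \<le> norm u \<Longrightarrow> ereal K < \<psi> u / ereal (norm u)"
    by (auto simp: eventually_at_infinity)
  \<comment> \<open>The radius is at least 1 so that outside the ball the division by
    \<open>norm u\<close> can be undone.\<close>
  obtain m where m: "\<And>u. u \<in> cball 0 (max R 1) \<Longrightarrow> ereal m \<le> \<psi> u"
    using bounded_below_on_compact[OF compact_cball] by blast
  define C where "C = \<bar>K\<bar> * max R 1 + \<bar>m\<bar>"
  have C: "0 \<le> C" by (simp add: C_def)
  have "ereal (K * norm u - C) \<le> \<psi> u" for u
  proof (cases "norm u \<le> max R 1")
    case True
    have "K * norm u \<le> \<bar>K\<bar> * norm u" by (intro mult_right_mono) auto
    also have "\<dots> \<le> \<bar>K\<bar> * max R 1" using True by (intro mult_left_mono) auto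
    finally have "ereal (K * norm u - C) \<le> ereal m" by (simp add: C_def)
    also have "\<dots> \<le> \<psi> u" using True by (intro m) simp
    finally show ?thesis .
  next
    case False
    then have "ereal K < \<psi> u / ereal (norm u)" "0 < norm u" using R[of u] by (auto intro: less_le_trans)
    then have "ereal (K * norm u) \<le> \<psi> u"
      using not_MInf[of u] by (cases "\<psi> u") (auto simp: field_simps)
    then show ?thesis using C by (cases "\<psi> u") auto
  qed
  then show thesis by (rule that)
qed

lemma conj_finite: "\<bar>fenchel_conj \<psi> y\<bar> \<noteq> \<infinity>"
proof -
  obtain C where C: "\<And>u. ereal (norm y * norm u - C) \<le> \<psi> u"
    using linear_lower_bound[where K = "norm y"] by blast
  have "fenchel_conj \<psi> y \<le> ereal C"
    unfolding fenchel_conj_def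
  proof (rule SUP_least)
    fix u
    show "ereal (y \<bullet> u) - \<psi> u \<le> ereal C"
      using C[of u] norm_cauchy_schwarz[of y u] by (cases "\<psi> u") auto
  qed
  then show ?thesis using conj_not_MInf[of y] by auto
qed

text \<open>The minorant of slope \<open>V + 1\<close> outgrows the inner product, which is at most
  \<open>V * norm x\<close>, by \<open>norm x\<close>; the conjugate is bounded below through one
  fixed point \<open>x0\<close>.\<close>

lemma approx_subgradient_bounded:
  obtains R where "0 \<le> R"
    "\<And>x y. norm y \<le> V \<Longrightarrow> \<psi> x + fenchel_conj \<psi> y \<le> ereal (y \<bullet> x + E) \<Longrightarrow> norm x \<le> R"
proof -
  obtain C where C: "\<And>u. ereal ((V + 1) * norm u - C) \<le> \<psi> u"
    using linear_lower_bound[where K = "V + 1"] by blast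
  obtain x0 r0 where x0: "\<psi> x0 = ereal r0" by (rule obtain_finite)
  have "norm x \<le> C + V * norm x0 + r0 + E"
    if y: "norm y \<le> V" and gap: "\<psi> x + fenchel_conj \<psi> y \<le> ereal (y \<bullet> x + E)" for x y
  proof -
    obtain a b where ab: "\<psi> x = ereal a" "fenchel_conj \<psi> y = ereal b"
      using fenchel_equality_finite[OF gap] by blast
    have "y \<bullet> x \<le> V * norm x"
      using norm_cauchy_schwarz[of y x] mult_right_mono[OF y, of "norm x"] by simp
    moreover have "- (y \<bullet> x0) \<le> V * norm x0"
      using norm_cauchy_schwarz[of "- y" x0] mult_right_mono[OF y, of "norm x0"] by simp
    ultimately show ?thesis
      using C[of x] fenchel_young[of y x0] gap ab x0 by (simp add: algebra_simps)
  qed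
  then show thesis by (intro that[of "max 0 (C + V * norm x0 + r0 + E)"]) (auto simp: le_max_iff_disj)
qed

text \<open>A near-maximizer in the supremum defining the conjugate at \<open>y\<close> has Fenchel
  gap at most 1, so its norm is bounded uniformly over the ball, and this bound is the Lipschitz
  constant.\<close>

lemma conj_lipschitz_on_ball:
  obtains L where "0 \<le> L"
    "\<And>y y'. norm y \<le> V \<Longrightarrow> norm y' \<le> V \<Longrightarrow>
       real_of_ereal (fenchel_conj \<psi> y) - real_of_ereal (fenchel_conj \<psi> y') \<le> L * norm (y - y')"
proof -
  obtain L where L: "0 \<le> L"
    "\<And>x y. norm y \<le> V \<Longrightarrow> \<psi> x + fenchel_conj \<psi> y \<le> ereal (y \<bullet> x + 1) \<Longrightarrow> norm x \<le> L"
    using approx_subgradient_bounded by metis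
  have "real_of_ereal (fenchel_conj \<psi> y) - real_of_ereal (fenchel_conj \<psi> y') \<le> L * norm (y - y')"
    if y: "norm y \<le> V" "norm y' \<le> V" for y y'
  proof (rule field_le_epsilon)
    fix e :: real assume e: "0 < e"
    obtain b b' where b: "fenchel_conj \<psi> y = ereal b" "fenchel_conj \<psi> y' = ereal b'"
      using conj_finite[of y] conj_finite[of y'] by auto
    \<comment> \<open>The slack is at most \<open>e\<close> for the final estimate and at most 1 for
      the bound on the near-maximizer.\<close>
    have "ereal (b - min e 1) < fenchel_conj \<psi> y" using b e by simp
    then obtain x where x: "ereal (b - min e 1) < ereal (y \<bullet> x) - \<psi> x"
      unfolding fenchel_conj_def less_SUP_iff by blast
    then obtain a where a: "\<psi> x = ereal a" using not_MInf[of x] by (cases "\<psi> x") auto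
    have "norm x \<le> L" using x a b by (intro L(2)[OF y(1)]) auto
    then have "(y - y') \<bullet> x \<le> L * norm (y - y')"
      using norm_cauchy_schwarz[of "y - y'" x] mult_left_mono[of "norm x" L "norm (y - y')"]
      by (simp add: mult.commute)
    then show "real_of_ereal (fenchel_conj \<psi> y) - real_of_ereal (fenchel_conj \<psi> y') \<le> L * norm (y - y') + e"
      using x a b fenchel_young[of y' x] by (auto simp: inner_diff_left)
  qed
  then show thesis using L(1) that by blast
qed

end

subsection \<open>Moreau envelopes\<close>

text \<open>The lower bound excludes minus infinity and a point of the domain excludes infinity, so
  \<open>real_of_ereal\<close> returns the infimum itself and not its default 0.\<close>

lemma moreau_env_approx:
  assumes "proper_function \<psi>" and lower: "\<And>x. ereal m \<le> prox_objective \<sigma> \<psi> p x" and e: "0 < e"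
  obtains x a where "\<psi> x = ereal a" "(norm (x - p))\<^sup>2 / (2 * \<sigma>) + a \<le> moreau_env \<sigma> \<psi> p + e"
proof -
  interpret proper_function \<psi> by fact
  let ?I = "INF x. prox_objective \<sigma> \<psi> p x"
  obtain x0 r0 where x0: "\<psi> x0 = ereal r0" by (rule obtain_finite)
  have "?I \<le> prox_objective \<sigma> \<psi> p x0" by (rule INF_lower) simp
  moreover have "ereal m \<le> ?I" by (rule INF_greatest) (rule lower)
  ultimately obtain i where i: "?I = ereal i"
    using x0 by (cases ?I) (auto simp: prox_objective_def)
  then have "?I < ereal (i + e)" using e by simp
  then obtain x where "prox_objective \<sigma> \<psi> p x < ereal (i + e)"
    unfolding INF_less_iff by blast
  then show thesis
    using that[of x] not_MInf[of x] i
    by (cases "\<psi> x") (auto simp: prox_objective_def moreau_env_def)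
qed

subsection \<open>The adjoint and the metric\<close>

lemma Q_adj_inner: "Q_adj A B w \<bullet> x = fst w \<bullet> (A *v x) + snd w \<bullet> (B *v x)"
  by (simp add: Q_adj_def inner_add_left dot_lmul_matrix flip: vector_transpose_matrix)

lemma linear_Q_adj: "linear (Q_adj A B)"
  by (rule linearI) (simp_all add: Q_adj_def matrix_vector_right_distrib matrix_vector_mult_scaleR
      scaleR_right_distrib)

lemmas Q_adj_diff = linear_diff[OF linear_Q_adj]

lemma tendsto_Q_adj: "(ws \<longlongrightarrow> l) F \<Longrightarrow> ((\<lambda>j. Q_adj A B (ws j)) \<longlongrightarrow> Q_adj A B l) F"
  by (rule bounded_linear.tendsto[OF linear_conv_bounded_linear[THEN iffD1, OF linear_Q_adj]])

lemma tendsto_matrix_vector_mult: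
  "(xs \<longlongrightarrow> l) F \<Longrightarrow> ((\<lambda>j. A *v xs j) \<longlongrightarrow> A *v (l :: real^'n)) F"
  by (rule bounded_linear.tendsto[OF matrix_vector_mul_bounded_linear])

lemma M_inner: "w \<bullet> M_map A B v = Q_adj A B w \<bullet> Q_adj A B v + w \<bullet> v"
  by (simp add: M_map_def Q_map_def inner_add_right Q_adj_inner inner_prod_def)

lemma M_norm_sq_eq: "M_norm_sq A B w = (norm (Q_adj A B w))\<^sup>2 + (norm w)\<^sup>2"
  by (simp add: M_norm_sq_def M_inner power2_norm_eq_inner)

lemma M_norm_sq_ge: "(norm w)\<^sup>2 \<le> M_norm_sq A B w"
  by (simp add: M_norm_sq_eq)

lemma M_norm_sq_nonneg: "0 \<le> M_norm_sq A B w"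
  by (simp add: M_norm_sq_eq)

text \<open>Drop the last square in |u|^2 - |v|^2 = 2 <u, u - v> - |u - v|^2, once for the vectors
  and once for their images under Q^T. Used both for the cost of resetting a coordinate and for the
  quasi-Fejer step.\<close>

lemma M_norm_sq_diff_le:
  "M_norm_sq A B a - M_norm_sq A B b
     \<le> 2 * (Q_adj A B a \<bullet> Q_adj A B (a - b) + a \<bullet> (a - b))"
proof -
  have *: "(norm u)\<^sup>2 - (norm v)\<^sup>2 \<le> 2 * (u \<bullet> (u - v))" for u v :: "'x::real_inner"
    using inner_ge_zero[of "u - v"]
    by (simp add: power2_norm_eq_inner inner_diff_left inner_diff_right inner_commute)
  show ?thesis
    using *[of a b] *[of "Q_adj A B a" "Q_adj A B b"] by (simp add: M_norm_sq_eq Q_adj_diff)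
qed

lemma norm_fst_snd_le: "norm (fst p) \<le> norm p" "norm (snd p) \<le> norm p"
  using norm_fst_le[of "fst p" "snd p"] norm_snd_le[of "snd p" "fst p"] by simp_all

lemma restrict_rows_nth: "restrict_rows T u $ i = (if i \<in> T then u $ i else 0)"
  by (simp add: restrict_rows_def)

lemma restrict_rows_inner:
  fixes u v :: "real^'p"
  shows "restrict_rows T u \<bullet> v = u \<bullet> restrict_rows T v"
  unfolding inner_vec_def by (intro sum.cong) (simp_all add: restrict_rows_nth)

lemma inner_disjoint_supp:
  fixes u v :: "real^'p"
  assumes "\<And>i. u $ i \<noteq> 0 \<Longrightarrow> v $ i = 0"
  shows "u \<bullet> v = 0"
  unfolding inner_vec_def by (rule sum.neutral) (use assms in auto)

subsection \<open>The zero norm\<close>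

lemma zero_norm_nonneg: "\<forall>i. lam $ i > 0 \<Longrightarrow> 0 \<le> zero_norm lam u"
  unfolding zero_norm_def by (intro sum_nonneg) (auto intro: less_imp_le)

lemma zero_norm_eq_supp: "zero_norm lam u = (\<Sum>i\<in>supp u. lam $ i)"
  unfolding zero_norm_def supp_def by (simp add: sum.If_cases)

lemma zero_norm_supp_mono:
  assumes "\<forall>i. lam $ i > 0" "supp u \<subseteq> supp v"
  shows "zero_norm lam u \<le> zero_norm lam v"
  unfolding zero_norm_eq_supp using assms by (intro sum_mono2) (auto intro: less_imp_le)

lemma zero_norm_supp_strict:
  assumes "\<forall>i. lam $ i > 0" "supp u \<subseteq> supp v" "i \<in> supp v" "i \<notin> supp u"
  shows "zero_norm lam u + lam $ i \<le> zero_norm lam v"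
proof -
  have "zero_norm lam u + lam $ i = (\<Sum>i\<in>insert i (supp u). lam $ i)"
    using assms by (simp add: zero_norm_eq_supp)
  also have "\<dots> \<le> (\<Sum>i\<in>supp v. lam $ i)"
    using assms by (intro sum_mono2) (auto intro: less_imp_le)
  finally show ?thesis by (simp add: zero_norm_eq_supp)
qed

lemma zero_norm_coordinate:
  assumes "\<And>j. j \<noteq> i \<Longrightarrow> u $ j = v $ j"
  shows "zero_norm lam u - (if u $ i \<noteq> 0 then lam $ i else 0)
       = zero_norm lam v - (if v $ i \<noteq> 0 then lam $ i else 0)"
proof -
  have "(\<Sum>j\<in>UNIV - {i}. if u $ j \<noteq> 0 then lam $ j else 0)
      = (\<Sum>j\<in>UNIV - {i}. if v $ j \<noteq> 0 then lam $ j else 0)"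
    by (intro sum.cong) (use assms in auto)
  then show ?thesis
    unfolding zero_norm_def by (simp add: sum.remove[of UNIV i])
qed

text \<open>Coordinatewise: where \<open>z $ i\<close> is nonzero, \<open>v $ i\<close> vanishes and
  \<open>u $ i\<close> stays nonzero; where it is zero, leaving zero costs the jump
  \<open>lam $ i\<close>, which beats the small linear term.\<close>

lemma zero_norm_local_growth:
  fixes lam z v :: "real^'p"
  assumes pos: "\<forall>i. lam $ i > 0" and v: "\<And>i. z $ i \<noteq> 0 \<Longrightarrow> v $ i = 0"
  shows "\<forall>\<^sub>F u in nhds z. v \<bullet> (u - z) \<le> zero_norm lam u - zero_norm lam z"
proof -
  have tend: "((\<lambda>u. u $ i) \<longlongrightarrow> z $ i) (nhds z)" for i
    by (rule tendsto_vec_nth) (rule filterlim_ident)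
  have "\<forall>\<^sub>F u in nhds z. z $ i \<noteq> 0 \<longrightarrow> u $ i \<noteq> 0" for i
    using tendsto_imp_eventually_ne[OF tend, of i 0] by (cases "z $ i = 0") auto
  moreover have "\<forall>\<^sub>F u in nhds z. v $ i * (u $ i - z $ i) < lam $ i" for i
  proof (rule order_tendstoD)
    show "((\<lambda>u. v $ i * (u $ i - z $ i)) \<longlongrightarrow> v $ i * (z $ i - z $ i)) (nhds z)"
      by (intro tendsto_intros tend)
    show "v $ i * (z $ i - z $ i) < lam $ i" using pos by simp
  qed
  ultimately have "\<forall>\<^sub>F u in nhds z. \<forall>i. (z $ i \<noteq> 0 \<longrightarrow> u $ i \<noteq> 0) \<and>
      v $ i * (u $ i - z $ i) < lam $ i"
    by (auto simp: eventually_all_finite eventually_conj_iff)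
  then show ?thesis
  proof eventually_elim
    case (elim u)
    have "v \<bullet> (u - z) = (\<Sum>i\<in>UNIV. v $ i * (u $ i - z $ i))"
      by (simp add: inner_vec_def)
    also have "\<dots> \<le> (\<Sum>i\<in>UNIV. (if u $ i \<noteq> 0 then lam $ i else 0)
                              - (if z $ i \<noteq> 0 then lam $ i else 0))"
    proof (rule sum_mono)
      fix i
      show "v $ i * (u $ i - z $ i)
          \<le> (if u $ i \<noteq> 0 then lam $ i else 0) - (if z $ i \<noteq> 0 then lam $ i else 0)"
        using elim[rule_format, of i] v[of i] by auto
    qed
    finally show ?case by (simp add: zero_norm_def sum_subtractf)
  qed
qed

subsection \<open>Stationary points and local minimizers\<close>

lemma subdiff_finite: "v \<in> subdiff \<psi> x \<Longrightarrow> \<bar>\<psi> x\<bar> \<noteq> \<infinity>"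
  by (simp add: subdiff_def)

lemma subdiff_ineq: "v \<in> subdiff \<psi> x \<Longrightarrow> \<psi> x + ereal (v \<bullet> (u - x)) \<le> \<psi> u"
  by (simp add: subdiff_def)

text \<open>The slopes of the three minorants, pulled back to x-space, sum to zero, so the minorants
  add up to a constant. Only the one of the zero norm is local.\<close>

lemma stationary_primal_local_minimizer:
  assumes lam: "\<forall>i. lam $ i > 0" and st: "stationary_primal f g A B lam x"
  shows "local_minimizer (primal_obj f g A B lam) x"
proof -
  obtain a b c where a: "a \<in> subdiff f x" and b: "b \<in> subdiff g (A *v x)"
    and c: "\<And>i. (B *v x) $ i \<noteq> 0 \<Longrightarrow> c $ i = 0"
    and sum: "a + transpose A *v b + transpose B *v c = 0"
    using st limiting_subdiff_zero_norm[OF lam] by (auto simp: stationary_primal_def)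
  obtain fx gx where fx: "f x = ereal fx" and gx: "g (A *v x) = ereal gx"
    using subdiff_finite[OF a] subdiff_finite[OF b] by auto
  have "((*v) B \<longlongrightarrow> B *v x) (nhds x)"
    by (rule tendsto_matrix_vector_mult) (rule filterlim_ident)
  then have "\<forall>\<^sub>F u in nhds x. c \<bullet> (B *v u - B *v x)
      \<le> zero_norm lam (B *v u) - zero_norm lam (B *v x)"
    using eventually_compose_filterlim[OF zero_norm_local_growth[OF lam c]] by blast
  then have "\<forall>\<^sub>F u in nhds x. primal_obj f g A B lam x \<le> primal_obj f g A B lam u"
  proof eventually_elim
    case (elim u)
    have "0 = (a + Q_adj A B (b, c)) \<bullet> (u - x)"
      using sum by (simp add: Q_adj_def add.assoc)
    then have "0 = a \<bullet> (u - x) + b \<bullet> (A *v u - A *v x) + c \<bullet> (B *v u - B *v x)"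
      by (simp add: inner_add_left Q_adj_inner matrix_vector_mult_diff_distrib)
    then show ?case
      using elim subdiff_ineq[OF a, of u] subdiff_ineq[OF b, of "A *v u"] fx gx
      by (cases "f u"; cases "g (A *v u)") (auto simp: primal_obj_def)
  qed
  then show ?thesis using fx gx by (simp add: local_minimizer_def primal_obj_def)
qed

lemma stationary_dual_local_minimizer:
  assumes mu: "\<forall>i. mu $ i > 0" and st: "stationary_dual f g A B mu w"
  shows "local_minimizer (dual_obj f g A B mu) w"
proof -
  obtain \<xi> where a: "\<xi> \<in> subdiff (fenchel_conj f) (- Q_adj A B w)"
    and b: "A *v \<xi> \<in> subdiff (fenchel_conj g) (fst w)"
    and c: "\<And>i. snd w $ i \<noteq> 0 \<Longrightarrow> (B *v \<xi>) $ i = 0"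
    using st limiting_subdiff_zero_norm[OF mu] by (auto simp: stationary_dual_def)
  obtain fx gx where fx: "fenchel_conj f (- Q_adj A B w) = ereal fx"
    and gx: "fenchel_conj g (fst w) = ereal gx"
    using subdiff_finite[OF a] subdiff_finite[OF b] by auto
  have "(snd \<longlongrightarrow> snd w) (nhds w)"
    by (rule tendsto_snd) (rule filterlim_ident)
  then have "\<forall>\<^sub>F v in nhds w. (B *v \<xi>) \<bullet> (snd v - snd w)
      \<le> zero_norm mu (snd v) - zero_norm mu (snd w)"
    using eventually_compose_filterlim[OF zero_norm_local_growth[OF mu c]] by blast
  then have "\<forall>\<^sub>F v in nhds w. dual_obj f g A B mu w \<le> dual_obj f g A B mu v"
  proof eventually_elim
    case (elim v)
    have "\<xi> \<bullet> (- Q_adj A B v - - Q_adj A B w) + (A *v \<xi>) \<bullet> (fst v - fst w)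
        + (B *v \<xi>) \<bullet> (snd v - snd w) = 0"
      using Q_adj_inner[of A B "v - w" \<xi>]
      by (simp add: Q_adj_diff inner_diff_left inner_diff_right inner_commute)
    then show ?case
      using elim subdiff_ineq[OF a, of "- Q_adj A B v"] subdiff_ineq[OF b, of "fst v"] fx gx
      by (cases "fenchel_conj f (- Q_adj A B v)"; cases "fenchel_conj g (fst v)")
        (auto simp: dual_obj_def Xi_def)
  qed
  then show ?thesis using fx gx by (simp add: local_minimizer_def dual_obj_def Xi_def)
qed

subsection \<open>Sequences\<close>

text \<open>Subtracting the partial sums of \<open>c\<close> leaves a sequence that is nonincreasing
  from \<open>K\<close> on. The subsequence bounds its limit above and nonnegativity of
  \<open>a\<close> bounds it below, both by \<open>- suminf c\<close>.\<close>

lemma quasi_Fejer_tendsto_zero: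
  fixes a c :: "nat \<Rightarrow> real"
  assumes nonneg: "\<And>k. 0 \<le> a k" and c: "summable c"
    and step: "\<And>k. K \<le> k \<Longrightarrow> a (Suc k) \<le> a k + c k"
    and r: "strict_mono r" "(a \<circ> r) \<longlonglongrightarrow> 0"
  shows "a \<longlonglongrightarrow> 0"
proof -
  define b where "b k = a k - sum c {..<k}" for k
  have dec: "b m \<le> b n" if "K \<le> n" "n \<le> m" for n m
    using that(2)
  proof (induction m rule: dec_induct)
    case (step m)
    then show ?case using assms(3)[of m] that(1) by (simp add: b_def)
  qed simp
  have sums: "(\<lambda>k. sum c {..<k}) \<longlonglongrightarrow> suminf c" using c by (rule summable_LIMSEQ)
  have "((\<lambda>k. (a \<circ> r) k - sum c {..<r k}) \<longlonglongrightarrow> 0 - suminf c)"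
    by (intro tendsto_diff r(2) filterlim_compose[OF sums] filterlim_subseq r(1))
  then have br: "(b \<circ> r) \<longlonglongrightarrow> - suminf c" by (simp add: b_def comp_def)
  have "b \<longlonglongrightarrow> - suminf c"
  proof (rule order_tendstoI)
    fix l assume l: "- suminf c < l"
    then have "\<forall>\<^sub>F k in sequentially. (b \<circ> r) k < l \<and> K \<le> k"
      using br by (auto dest: order_tendstoD simp: eventually_conj_iff eventually_ge_at_top)
    then obtain k where k: "b (r k) < l" "K \<le> k"
      using eventually_happens by fastforce
    have "K \<le> r k" using k(2) seq_suble[OF r(1), of k] by simp
    then show "\<forall>\<^sub>F k in sequentially. b k < l"
      using dec k(1) by (auto simp: eventually_sequentially intro: le_less_trans)
  next
    fix l assume "l < - suminf c"
    moreover have "(\<lambda>k. - sum c {..<k}) \<longlonglongrightarrow> - suminf c" by (intro tendsto_minus sums)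
    ultimately have "\<forall>\<^sub>F k in sequentially. l < - sum c {..<k}" by (rule order_tendstoD(1)[rotated])
    then show "\<forall>\<^sub>F k in sequentially. l < b k"
      by eventually_elim (use nonneg in \<open>auto simp: b_def intro: less_le_trans\<close>)
  qed
  then have "(\<lambda>k. b k + sum c {..<k}) \<longlonglongrightarrow> - suminf c + suminf c" by (intro tendsto_add sums)
  then show ?thesis by (simp add: b_def)
qed

text \<open>Abstract form of a coordinate sweep: \<open>F U\<close> stands for the value once the
  coordinates in \<open>U\<close> are updated. The induction removes the largest element of
  \<open>V\<close>, which undoes one coordinate step.\<close>

lemma downset_chain_antimono:
  fixes F :: "'p::{finite,linorder} set \<Rightarrow> real"
  assumes step: "\<And>i. F {..i} \<le> F {..<i}"
    and U: "\<And>i j. i \<in> U \<Longrightarrow> j \<le> i \<Longrightarrow> j \<in> U" and V: "\<And>i j. i \<in> V \<Longrightarrow> j \<le> i \<Longrightarrow> j \<in> V"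
    and "U \<subseteq> V"
  shows "F V \<le> F U"
  using V \<open>U \<subseteq> V\<close>
proof (induction "card V" arbitrary: V rule: less_induct)
  case less
  show ?case
  proof (cases "U = V")
    case False
    define m where "m = Max V"
    have "V \<noteq> {}" using False less.prems(2) by auto
    then have m: "m \<in> V" "\<And>j. j \<in> V \<Longrightarrow> j \<le> m" by (auto simp: m_def)
    then have V: "V = {..m}" using less.prems(1) by auto
    have "m \<notin> U" using False V less.prems(2) U by blast
    then have "U \<subseteq> {..<m}" using less.prems(2) V by (auto simp: order_less_le)
    moreover have "card {..<m} < card V" unfolding V by (intro psubset_card_mono) auto
    ultimately have "F {..<m} \<le> F U" by (intro less.hyps) auto
    then show ?thesis using step[of m] V by simp
  qed simp
qed

subsection \<open>The duality gap of a subproblem\<close>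

lemma complete_square:
  fixes d v :: "'a::real_inner"
  assumes "0 < c"
  shows "c / 2 * (norm (d + (1 / c) *\<^sub>R v))\<^sup>2 = c / 2 * (norm d)\<^sup>2 + d \<bullet> v + (norm v)\<^sup>2 / (2 * c)"
  using assms
  by (simp add: power2_norm_eq_inner inner_add_left inner_add_right inner_commute field_simps)

text \<open>Up to the slack of near-minimizers of the two Moreau envelopes, the gap is the sum of two
  Fenchel gaps and two squares, so it controls each of these four terms.\<close>

lemma duality_gap_control:
  fixes f :: "real^'n \<Rightarrow> ereal" and g :: "real^'m \<Rightarrow> ereal"
    and w wp :: "(real^'m) \<times> (real^'p)"
  assumes f: "superlinear_function f" and g: "proper_function g"
    and c: "0 < c" and \<epsilon>: "0 \<le> \<epsilon>" and \<delta>: "0 < \<delta>"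
    and zp: "snd wp = restrict_rows T (snd w + c *\<^sub>R (B *v x))"
    and gap: "duality_gap f g A B c w T x wp \<le> ereal (\<epsilon>\<^sup>2 / (2 * c))"
    and \<rho>: "\<rho> = \<epsilon> / c + \<delta>"
  obtains xp up where
    "f xp + fenchel_conj f (- Q_adj A B wp) \<le> ereal (- Q_adj A B wp \<bullet> xp + c / 2 * \<rho>\<^sup>2)"
    "norm (xp - x + (1 / c) *\<^sub>R (Q_adj A B w - Q_adj A B wp)) \<le> \<rho>"
    "g up + fenchel_conj g (fst wp) \<le> ereal (fst wp \<bullet> up + c / 2 * \<rho>\<^sup>2)"
    "norm (up - A *v x + (1 / c) *\<^sub>R (fst wp - fst w)) \<le> \<rho>"
proof -
  interpret F: superlinear_function f by fact
  interpret G: proper_function g by fact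
  define a b where "a = Q_adj A B w" and "b = Q_adj A B wp"
  obtain y z where w: "w = (y, z)" by (cases w)
  obtain y' z' where wp: "wp = (y', z')" by (cases wp)
  obtain fb where fb: "fenchel_conj f (- b) = ereal fb" using F.conj_finite[of "- b"] by auto
  obtain gy where gy: "fenchel_conj g y' = ereal gy"
    using gap G.conj_not_MInf[of y'] fb
    by (cases "fenchel_conj g y'") (auto simp: duality_gap_def Xi_prox_def Xi_def wp b_def)
  \<comment> \<open>Two envelopes with slack \<open>e\<close> each lose c/2 * delta^2 in total.
    Together with epsilon^2 / (2c) = c/2 * (epsilon/c)^2 this fits under c/2 * (epsilon/c +
    delta)^2.\<close>
  define e where "e = c * \<delta>\<^sup>2 / 4"
  have e: "0 < e" using c \<delta> by (simp add: e_def)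

  define pf where "pf = x - (1 / c) *\<^sub>R a"
  obtain C where C: "\<And>u. ereal (0 * norm u - C) \<le> f u"
    using F.linear_lower_bound[where K = 0] by blast
  have "ereal (- C) \<le> prox_objective (1 / c) f pf u" for u
    using C[of u] c by (cases "f u") (auto simp: prox_objective_def intro: add_increasing)
  then obtain xp fx where fx: "f xp = ereal fx"
    and xp: "(norm (xp - pf))\<^sup>2 / (2 * (1 / c)) + fx \<le> moreau_env (1 / c) f pf + e"
    using moreau_env_approx[OF F.proper_function_axioms _ e] by metis

  define pg where "pg = A *v x + (1 / c) *\<^sub>R y"
  \<comment> \<open>A lower bound for the envelope of \<open>g\<close>: the affine minorant of slope
    \<open>y'\<close>, available because the finite gap makes the conjugate finite there, plus the
    quadratic term.\<close>
  have "ereal (y' \<bullet> pg - gy - (norm y')\<^sup>2 / (2 * c)) \<le> prox_objective (1 / c) g pg u" for u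
  proof -
    have "0 \<le> c / 2 * (norm (u - pg + (1 / c) *\<^sub>R y'))\<^sup>2" using c by simp
    also have "\<dots> = (norm (u - pg))\<^sup>2 / (2 * (1 / c)) + (y' \<bullet> u - y' \<bullet> pg) + (norm y')\<^sup>2 / (2 * c)"
      unfolding complete_square[OF c] by (simp add: inner_diff_right inner_commute[of _ y'])
    finally show ?thesis
      using G.fenchel_young[of y' u] gy G.not_MInf[of u]
      by (cases "g u") (auto simp: prox_objective_def)
  qed
  then obtain up gx where gx: "g up = ereal gx"
    and up: "(norm (up - pg))\<^sup>2 / (2 * (1 / c)) + gx \<le> moreau_env (1 / c) g pg + e"
    using moreau_env_approx[OF g _ e] by metis

  define gapf where "gapf = fx + fb + b \<bullet> xp"
  define gapg where "gapg = gx + gy - y' \<bullet> up"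
  define rf where "rf = xp - x + (1 / c) *\<^sub>R (a - b)"
  define rg where "rg = up - A *v x + (1 / c) *\<^sub>R (y' - y)"
  have nonneg: "0 \<le> gapf" "0 \<le> gapg"
    using F.fenchel_young[of "- b" xp] G.fenchel_young[of y' up] fx gx fb gy
    by (auto simp: gapf_def gapg_def)
  \<comment> \<open>The envelope's square is centred at \<open>pf\<close>. Recentring it at the
    residual \<open>rf\<close> produces |b - a|^2 / (2c), which is the Q^T part of the proximal
    term.\<close>
  have 1: "c / 2 * (norm rf)\<^sup>2 + gapf
      \<le> f_sub f A B c w x + e + (norm (b - a))\<^sup>2 / (2 * c) + fb + b \<bullet> x"
  proof -
    have eq: "xp - pf = xp - x + (1 / c) *\<^sub>R a" by (simp add: pf_def)
    have "c / 2 * (norm (xp - pf))\<^sup>2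
        = c / 2 * (norm (xp - x))\<^sup>2 + (xp - x) \<bullet> a + (norm a)\<^sup>2 / (2 * c)"
      unfolding eq by (rule complete_square[OF c])
    moreover have "c / 2 * (norm rf)\<^sup>2
        = c / 2 * (norm (xp - x))\<^sup>2 + ((xp - x) \<bullet> a - (xp - x) \<bullet> b) + (norm (b - a))\<^sup>2 / (2 * c)"
      unfolding rf_def complete_square[OF c] inner_diff_right by (simp add: norm_minus_commute)
    moreover have "(xp - x) \<bullet> b = b \<bullet> xp - b \<bullet> x"
      by (simp add: inner_diff_left inner_diff_right inner_commute)
    moreover have "f_sub f A B c w x = moreau_env (1 / c) f pf - (norm a)\<^sup>2 / (2 * c)"
      by (simp add: f_sub_def pf_def a_def)
    moreover have "c / 2 * (norm (xp - pf))\<^sup>2 + fx \<le> moreau_env (1 / c) f pf + e"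
      using xp by (simp add: mult.commute)
    ultimately show ?thesis unfolding gapf_def by linarith
  qed
  have 2: "c / 2 * (norm rg)\<^sup>2 + gapg
      \<le> g_sub g c w (A *v x) + e + (norm (y' - y))\<^sup>2 / (2 * c) + gy - y' \<bullet> (A *v x)"
  proof -
    have eq: "up - pg = up - A *v x + (1 / c) *\<^sub>R (- y)" by (simp add: pg_def)
    have "c / 2 * (norm (up - pg))\<^sup>2
        = c / 2 * (norm (up - A *v x))\<^sup>2 - (up - A *v x) \<bullet> y + (norm y)\<^sup>2 / (2 * c)"
      unfolding eq complete_square[OF c] by simp
    moreover have "c / 2 * (norm rg)\<^sup>2
        = c / 2 * (norm (up - A *v x))\<^sup>2 + ((up - A *v x) \<bullet> y' - (up - A *v x) \<bullet> y)
          + (norm (y' - y))\<^sup>2 / (2 * c)"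
      unfolding rg_def complete_square[OF c] inner_diff_right by simp
    moreover have "(up - A *v x) \<bullet> y' = y' \<bullet> up - y' \<bullet> (A *v x)"
      by (simp add: inner_diff_left inner_diff_right inner_commute)
    moreover have "g_sub g c w (A *v x) = moreau_env (1 / c) g pg - (norm y)\<^sup>2 / (2 * c)"
      by (simp add: g_sub_def pg_def w)
    moreover have "c / 2 * (norm (up - pg))\<^sup>2 + gx \<le> moreau_env (1 / c) g pg + e"
      using up by (simp add: mult.commute)
    ultimately show ?thesis unfolding gapg_def by linarith
  qed
  \<comment> \<open>The z block closes with equality, because \<open>z'\<close> is given by an
    explicit formula.\<close>
  have 3: "h_sub c w T (B *v x) + (norm (z' - z))\<^sup>2 / (2 * c) = z' \<bullet> (B *v x)"
  proof -
    have z': "z' = restrict_rows T (z + c *\<^sub>R (B *v x))" using zp w wp by simp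
    have "restrict_rows T (B *v x + (1 / c) *\<^sub>R z) = (1 / c) *\<^sub>R z'"
      using c by (simp add: z' vec_eq_iff restrict_rows_nth field_simps)
    then have h: "h_sub c w T (B *v x) = (norm z')\<^sup>2 / (2 * c) - (norm z)\<^sup>2 / (2 * c)"
      using c by (simp add: h_sub_def w power2_eq_square field_simps)
    have "restrict_rows T z' = z'" by (simp add: z' vec_eq_iff restrict_rows_nth)
    then have "z' \<bullet> z' = z' \<bullet> (z + c *\<^sub>R (B *v x))"
      using restrict_rows_inner[of T z' "z + c *\<^sub>R (B *v x)"] by (simp flip: z')
    then show ?thesis
      using c unfolding h
      by (simp add: power2_norm_eq_inner inner_diff_left inner_diff_right inner_add_right
          inner_commute field_simps)
  qed
  have M: "M_norm_sq A B (wp - w) = (norm (b - a))\<^sup>2 + (norm (y' - y))\<^sup>2 + (norm (z' - z))\<^sup>2"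
    by (simp add: M_norm_sq_eq Q_adj_diff[symmetric] a_def b_def w wp norm_prod_def)
  have "Psi f g A B c w T x + (fb + gy + M_norm_sq A B (wp - w) / (2 * c)) \<le> \<epsilon>\<^sup>2 / (2 * c)"
    using gap fb gy by (simp add: duality_gap_def Xi_prox_def Xi_def wp b_def)
  \<comment> \<open>With this identity the linear terms left over in the three estimates
    cancel.\<close>
  moreover have "b \<bullet> x = y' \<bullet> (A *v x) + z' \<bullet> (B *v x)"
    by (simp add: b_def Q_adj_inner wp)
  ultimately have "c / 2 * (norm rf)\<^sup>2 + gapf + (c / 2 * (norm rg)\<^sup>2 + gapg)
      \<le> \<epsilon>\<^sup>2 / (2 * c) + 2 * e"
    using 1 2 3 unfolding Psi_def M by (simp add: add_divide_distrib)
  also have "\<dots> = c / 2 * ((\<epsilon> / c)\<^sup>2 + \<delta>\<^sup>2)"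
    using c by (simp add: e_def field_simps power2_eq_square)
  also have "\<dots> \<le> c / 2 * \<rho>\<^sup>2"
    using c \<epsilon> \<delta> unfolding \<rho> by (intro mult_left_mono) (auto simp: power2_sum)
  finally have total: "c / 2 * (norm rf)\<^sup>2 + gapf + (c / 2 * (norm rg)\<^sup>2 + gapg) \<le> c / 2 * \<rho>\<^sup>2" .
  have sq: "0 \<le> c / 2 * (norm rf)\<^sup>2" "0 \<le> c / 2 * (norm rg)\<^sup>2" using c by auto
  have \<rho>0: "0 \<le> \<rho>" using c \<epsilon> \<delta> by (simp add: \<rho>)
  show thesis
  proof
    show "f xp + fenchel_conj f (- Q_adj A B wp) \<le> ereal (- Q_adj A B wp \<bullet> xp + c / 2 * \<rho>\<^sup>2)"
      using total nonneg sq fx fb by (simp add: gapf_def b_def)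
    show "g up + fenchel_conj g (fst wp) \<le> ereal (fst wp \<bullet> up + c / 2 * \<rho>\<^sup>2)"
      using total nonneg sq gx gy by (simp add: gapg_def wp)
    have "c / 2 * (norm rf)\<^sup>2 \<le> c / 2 * \<rho>\<^sup>2" "c / 2 * (norm rg)\<^sup>2 \<le> c / 2 * \<rho>\<^sup>2"
      using total nonneg sq by linarith+
    then have "(norm rf)\<^sup>2 \<le> \<rho>\<^sup>2" "(norm rg)\<^sup>2 \<le> \<rho>\<^sup>2" using c by auto
    then have "norm rf \<le> \<rho>" "norm rg \<le> \<rho>" using \<rho>0 by (auto intro: power2_le_imp_le)
    then show "norm (xp - x + (1 / c) *\<^sub>R (Q_adj A B w - Q_adj A B wp)) \<le> \<rho>"
      and "norm (up - A *v x + (1 / c) *\<^sub>R (fst wp - fst w)) \<le> \<rho>"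
      by (simp_all add: rf_def rg_def a_def b_def w wp)
  qed
qed

subsection \<open>Descent of the dual objective\<close>

locale ppsna_run = F: superlinear_function f + G: proper_closed_function g
  for f :: "real^'n \<Rightarrow> ereal" and g :: "real^'m \<Rightarrow> ereal" +
  fixes A :: "real^'n^'m"
    and B :: "real^'n^'p::{finite,linorder}"
    and mu :: "real^'p::{finite,linorder}"
    and \<gamma> \<epsilon> :: "nat \<Rightarrow> real"
    and x :: "nat \<Rightarrow> real^'n"
    and w :: "nat \<Rightarrow> (real^'m) \<times> (real^'p::{finite,linorder})"
    and zt :: "nat \<Rightarrow> real^'p::{finite,linorder}"
  assumes mu: "\<forall>i. mu $ i > 0"
    and y0: "fst (w 0) \<in> edom (fenchel_conj g)"
    and \<gamma>0: "\<gamma> 0 > 0" and \<gamma>_incseq: "incseq \<gamma>" and \<gamma>_convergent: "convergent \<gamma>"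
    and coord: "coord_min f g A B mu (\<gamma> k) (w k) (zt k)"
    and z_update: "snd (w (Suc k))
      = restrict_rows (supp (zt k)) (snd (w k) + \<gamma> k *\<^sub>R (B *v x (Suc k)))"
    and C1: "Xi_prox f g A B (\<gamma> k) (w k) (w (Suc k)) - Xi_prox f g A B (\<gamma> k) (w k) (fst (w k), zt k)
               \<le> ereal (M_norm_sq A B (w (Suc k) - w k) / (4 * \<gamma> k))"
    and C2: "duality_gap f g A B (\<gamma> k) (w k) (supp (zt k)) (x (Suc k)) (w (Suc k))
               \<le> ereal ((\<epsilon> k)\<^sup>2 / (2 * \<gamma> k))"
    and \<epsilon>_nonneg: "\<epsilon> k \<ge> 0" and \<epsilon>_summable: "summable \<epsilon>"
    and bounded_w: "bounded (range w)"
begin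

section \<open>Proximal parameters and real-valued conjugates\<close>

lemma \<gamma>_ge: "\<gamma> 0 \<le> \<gamma> k"
  using \<gamma>_incseq by (simp add: incseq_def)

lemma \<gamma>_pos: "0 < \<gamma> k"
  using \<gamma>0 \<gamma>_ge[of k] by linarith

definition "\<gamma>_lim = lim \<gamma>"

lemma \<gamma>_le: "\<gamma> k \<le> \<gamma>_lim"
  using \<gamma>_incseq \<gamma>_convergent unfolding \<gamma>_lim_def
  by (intro incseq_le) (auto simp: convergent_LIMSEQ_iff)

lemma \<gamma>_lim_pos: "0 < \<gamma>_lim"
  using \<gamma>_pos[of 0] \<gamma>_le[of 0] by linarith

definition "fc v = real_of_ereal (fenchel_conj f v)"

text \<open>Meaningful only where the conjugate is finite, in particular at the iterates
  \<open>fst (w k)\<close>; at infinite values it defaults to 0.\<close>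

definition "gc y = real_of_ereal (fenchel_conj g y)"

lemma fc: "fenchel_conj f v = ereal (fc v)"
  using F.conj_finite[of v] by (simp add: ereal_real fc_def)

text \<open>For \<open>k = 0\<close> this is the choice of the starting point; afterwards (C2)
  bounds a sum whose remaining terms are finite.\<close>

lemma gc: "fenchel_conj g (fst (w k)) = ereal (gc (fst (w k)))"
proof -
  have "fenchel_conj g (fst (w k)) \<noteq> \<infinity>"
  proof (cases k)
    case 0
    then show ?thesis using y0 by (auto simp: edom_def)
  next
    case (Suc l)
    then show ?thesis
      using C2[of l] fc[of "- Q_adj A B (w k)"] by (auto simp: duality_gap_def Xi_prox_def Xi_def)
  qed
  then show ?thesis
    using G.conj_not_MInf[of "fst (w k)"] by (cases "fenchel_conj g (fst (w k))") (auto simp: gc_def)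
qed

text \<open>The proximal dual objective at fixed y-part, with the entire zero norm instead of the
  penalty of one coordinate: all coordinate steps of a sweep then decrease one and the same
  function.\<close>

definition model :: "nat \<Rightarrow> (real, 'p) vec \<Rightarrow> real"
  where "model k v = fc (- Q_adj A B (fst (w k), v)) + gc (fst (w k))
    + M_norm_sq A B ((fst (w k), v) - w k) / (2 * \<gamma> k) + zero_norm mu v"

definition dual_value :: "nat \<Rightarrow> real"
  where "dual_value k = fc (- Q_adj A B (w k)) + gc (fst (w k)) + zero_norm mu (snd (w k))"

lemma model_current: "model k (snd (w k)) = dual_value k"
  by (simp add: model_def dual_value_def M_norm_sq_eq linear_0[OF linear_Q_adj])

lemma Xi_prox_model:
  "Xi_prox f g A B (\<gamma> k) (w k) (fst (w k), v) = ereal (model k v - zero_norm mu v)"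
  by (simp add: Xi_prox_def Xi_def model_def gc fc)

lemma coordinate_decrease:
  "model k (gs_vec (zt k) (snd (w k)) i (zt k $ i)) \<le> model k (gs_vec (zt k) (snd (w k)) i t)"
proof -
  let ?v = "gs_vec (zt k) (snd (w k)) i"
  have "ereal (model k (?v (zt k $ i)) - zero_norm mu (?v (zt k $ i)) + (if zt k $ i \<noteq> 0 then mu $ i else 0))
      \<le> ereal (model k (?v t) - zero_norm mu (?v t) + (if t \<noteq> 0 then mu $ i else 0))"
    using coord[of k] unfolding coord_min_def is_arg_min_linorder Xi_prox_model
    by (metis plus_ereal.simps(1))
  moreover have "?v s $ i = s" for s by (simp add: gs_vec_def)
  moreover have "zero_norm mu (?v (zt k $ i)) - (if ?v (zt k $ i) $ i \<noteq> 0 then mu $ i else 0)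
      = zero_norm mu (?v t) - (if ?v t $ i \<noteq> 0 then mu $ i else 0)"
    by (rule zero_norm_coordinate) (simp add: gs_vec_def)
  ultimately show ?thesis by simp
qed

text \<open>No coordinate step increases the model, so the gain of step \<open>i\<close> against any
  competitor \<open>t\<close> is at most the gain of the whole sweep. The vector with the old
  \<open>i\<close>-th entry is the point just before step \<open>i\<close>.\<close>

lemma sweep_decrease:
  "model k (gs_vec (zt k) (snd (w k)) i (snd (w k) $ i)) - model k (gs_vec (zt k) (snd (w k)) i t)
     \<le> dual_value k - model k (zt k)" (is ?partial)
  "model k (zt k) \<le> dual_value k" (is ?total)
proof -
  define mix where "mix U = (\<chi> j. if j \<in> U then zt k $ j else snd (w k) $ j)" for U
  have upto: "mix {..i} = gs_vec (zt k) (snd (w k)) i (zt k $ i)" for i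
    by (auto simp: mix_def gs_vec_def vec_eq_iff)
  have below: "mix {..<i} = gs_vec (zt k) (snd (w k)) i (snd (w k) $ i)" for i
    by (auto simp: mix_def gs_vec_def vec_eq_iff)
  have "model k (mix {..i}) \<le> model k (mix {..<i})" for i
    unfolding upto below by (rule coordinate_decrease)
  note antimono = downset_chain_antimono[of "\<lambda>U. model k (mix U)", OF this]
  have mix: "mix {} = snd (w k)" "mix UNIV = zt k" by (simp_all add: mix_def vec_eq_iff)
  have "model k (mix {..<i}) \<le> model k (mix {})" "model k (mix UNIV) \<le> model k (mix {..i})"
    by (rule antimono; auto)+
  then show ?partial
    using coordinate_decrease[of k i t] unfolding upto below by (simp add: mix model_current)
  have "model k (mix UNIV) \<le> model k (mix {})" by (rule antimono) auto
  then show ?total by (simp add: mix model_current)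
qed

text \<open>The new proximal value contains the squared M-step over 2 gamma_k, while (C1) concedes
  only half of that; the other half is the decrease. The zero norm difference is kept because it
  later shows that no index of \<open>zt k\<close> is lost.\<close>

lemma dual_value_decrease:
  "dual_value (Suc k) + (norm (w (Suc k) - w k))\<^sup>2 / (4 * \<gamma>_lim)
     + (zero_norm mu (zt k) - zero_norm mu (snd (w (Suc k)))) \<le> model k (zt k)"
proof -
  let ?M = "M_norm_sq A B (w (Suc k) - w k)"
  have "Xi_prox f g A B (\<gamma> k) (w k) (w (Suc k))
      = ereal (dual_value (Suc k) - zero_norm mu (snd (w (Suc k))) + ?M / (2 * \<gamma> k))"
    by (simp add: Xi_prox_def Xi_def dual_value_def gc fc)
  then have "dual_value (Suc k) - zero_norm mu (snd (w (Suc k))) + ?M / (2 * \<gamma> k)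
      - (model k (zt k) - zero_norm mu (zt k)) \<le> ?M / (4 * \<gamma> k)"
    using C1[of k] by (simp add: Xi_prox_model)
  moreover have "(norm (w (Suc k) - w k))\<^sup>2 / (4 * \<gamma>_lim) \<le> ?M / (4 * \<gamma> k)"
    using M_norm_sq_ge[of "w (Suc k) - w k" A B] \<gamma>_pos[of k] \<gamma>_le[of k]
    by (intro frac_le M_norm_sq_nonneg) auto
  moreover have "?M / (2 * \<gamma> k) = ?M / (4 * \<gamma> k) + ?M / (4 * \<gamma> k)" by simp
  ultimately show ?thesis by linarith
qed

section \<open>Vanishing decrease and vanishing steps of the dual iterates\<close>

lemma supp_update: "supp (snd (w (Suc k))) \<subseteq> supp (zt k)"
  unfolding z_update by (auto simp: supp_def restrict_rows_nth)

lemma dual_value_antimono: "dual_value (Suc k) \<le> dual_value k"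
proof -
  have "0 \<le> (norm (w (Suc k) - w k))\<^sup>2 / (4 * \<gamma>_lim)" using \<gamma>_lim_pos by simp
  then show ?thesis
    using dual_value_decrease[of k] sweep_decrease(2)[of k]
      zero_norm_supp_mono[OF mu supp_update[of k]] by linarith
qed

text \<open>Fenchel-Young at one point of each domain. The variable \<open>z\<close> is free, so the
  bound also covers the outcomes of the coordinate sweep.\<close>

lemma conj_affine_bound:
  "\<exists>a u v. \<forall>k z. fst (w k) \<bullet> u - z \<bullet> v - a \<le> fc (- Q_adj A B (fst (w k), z)) + gc (fst (w k))"
proof -
  obtain x0 r0 where x0: "f x0 = ereal r0" by (rule F.obtain_finite)
  obtain u0 s0 where u0: "g u0 = ereal s0" by (rule G.obtain_finite)
  have "fc (- Q_adj A B (fst (w k), z)) + gc (fst (w k))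
      \<ge> fst (w k) \<bullet> (u0 - A *v x0) - z \<bullet> (B *v x0) - (r0 + s0)" for k z
    using F.fenchel_young[of "- Q_adj A B (fst (w k), z)" x0] G.fenchel_young[of "fst (w k)" u0]
    by (simp add: x0 u0 fc gc Q_adj_inner inner_diff_right)
  then show ?thesis by blast
qed

lemma obtain_w_bound:
  obtains W where "0 < W" "\<And>k. norm (w k) \<le> W" "\<And>k. norm (fst (w k)) \<le> W"
    "\<And>k. norm (snd (w k)) \<le> W"
proof -
  obtain W where "0 < W" and W: "norm (w k) \<le> W" for k
    using bounded_w unfolding bounded_pos by blast
  moreover have "norm (fst (w k)) \<le> W" "norm (snd (w k)) \<le> W" for k
    using W[of k] norm_fst_snd_le[of "w k"] by linarith+
  ultimately show thesis by (intro that)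
qed

lemma dual_value_convergent: "convergent dual_value"
proof -
  obtain W where W: "0 < W" "\<And>k. norm (w k) \<le> W"
    and n: "\<And>k. norm (fst (w k)) \<le> W" "\<And>k. norm (snd (w k)) \<le> W"
    using obtain_w_bound by blast
  obtain a u v where auv:
    "\<forall>k z. fst (w k) \<bullet> u - z \<bullet> v - a \<le> fc (- Q_adj A B (fst (w k), z)) + gc (fst (w k))"
    using conj_affine_bound by blast
  have "- (W * norm u + W * norm v + a) \<le> dual_value k" for k
  proof -
    have "\<bar>fst (w k) \<bullet> u\<bar> \<le> W * norm u" "\<bar>snd (w k) \<bullet> v\<bar> \<le> W * norm v"
      using Cauchy_Schwarz_ineq2 n[of k] by (meson mult_right_mono norm_ge_zero order_trans)+
    then show ?thesis
      using auv[rule_format, of k "snd (w k)"] zero_norm_nonneg[OF mu, of "snd (w k)"]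
      by (simp add: dual_value_def)
  qed
  then show ?thesis
    using decseq_convergent[of dual_value] decseq_SucI[of dual_value, OF dual_value_antimono]
    by (metis convergentI)
qed

lemma dual_value_decrease_tendsto: "(\<lambda>k. dual_value k - dual_value (Suc k)) \<longlonglongrightarrow> 0"
proof -
  obtain l where l: "dual_value \<longlonglongrightarrow> l"
    using dual_value_convergent by (auto simp: convergent_def)
  have "(\<lambda>k. dual_value k - dual_value (Suc k)) \<longlonglongrightarrow> l - l"
    by (intro tendsto_diff l LIMSEQ_Suc)
  then show ?thesis by simp
qed

lemma w_step_tendsto: "(\<lambda>k. w (Suc k) - w k) \<longlonglongrightarrow> 0"
proof -
  have le: "(norm (w (Suc k) - w k))\<^sup>2 \<le> 4 * \<gamma>_lim * (dual_value k - dual_value (Suc k))" for k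
  proof -
    have "(norm (w (Suc k) - w k))\<^sup>2 / (4 * \<gamma>_lim) \<le> dual_value k - dual_value (Suc k)"
      using dual_value_decrease[of k] sweep_decrease(2)[of k]
        zero_norm_supp_mono[OF mu supp_update[of k]] by linarith
    then show ?thesis using \<gamma>_lim_pos by (simp add: field_simps)
  qed
  have "(\<lambda>k. 4 * \<gamma>_lim * (dual_value k - dual_value (Suc k))) \<longlonglongrightarrow> 0"
    using tendsto_mult_right_zero[OF dual_value_decrease_tendsto] by simp
  then have "(\<lambda>k. (norm (w (Suc k) - w k))\<^sup>2) \<longlonglongrightarrow> 0"
    by (rule Lim_null_comparison[rotated]) (simp add: le)
  then have "(\<lambda>k. sqrt ((norm (w (Suc k) - w k))\<^sup>2)) \<longlonglongrightarrow> sqrt 0" by (rule tendsto_real_sqrt)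
  then show ?thesis by (simp add: tendsto_norm_zero_iff)
qed

subsection \<open>Identification of the support\<close>

text \<open>In the step length t the model grows quadratically up to an affine minorant, but its
  value never exceeds the initial dual value.\<close>

lemma zt_bounded: obtains Z where "0 \<le> Z" "\<And>k. norm (zt k) \<le> Z"
proof -
  obtain W where W: "0 < W" "\<And>k. norm (w k) \<le> W"
    and n: "\<And>k. norm (fst (w k)) \<le> W" "\<And>k. norm (snd (w k)) \<le> W"
    using obtain_w_bound by blast
  obtain a u v where auv:
    "\<forall>k z. fst (w k) \<bullet> u - z \<bullet> v - a \<le> fc (- Q_adj A B (fst (w k), z)) + gc (fst (w k))"
    using conj_affine_bound by blast
  define b where "b = \<bar>dual_value 0\<bar> + W * norm u + W * norm v + \<bar>a\<bar>"
  have b: "0 \<le> b" using W(1) by (simp add: b_def)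
  have "norm (zt k) \<le> W + (1 + 2 * \<gamma>_lim * (b + norm v))" for k
  proof -
    define t where "t = norm (zt k - snd (w k))"
    have "dual_value k \<le> dual_value 0"
      using decseq_SucI[of dual_value] dual_value_antimono by (simp add: decseq_def)
    then have le: "model k (zt k) \<le> dual_value 0" using sweep_decrease(2)[of k] by linarith
    have fu: "\<bar>fst (w k) \<bullet> u\<bar> \<le> W * norm u" and zv: "\<bar>snd (w k) \<bullet> v\<bar> \<le> W * norm v"
      using Cauchy_Schwarz_ineq2 n[of k] by (meson mult_right_mono norm_ge_zero order_trans)+
    have "\<bar>(zt k - snd (w k)) \<bullet> v\<bar> \<le> t * norm v" unfolding t_def by (rule Cauchy_Schwarz_ineq2)
    then have ztv: "zt k \<bullet> v \<le> t * norm v + W * norm v" using zv by (auto simp: inner_diff_left)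
    have "norm ((fst (w k), zt k) - w k) = t"
      by (simp add: t_def norm_prod_def)
    then have "t\<^sup>2 \<le> M_norm_sq A B ((fst (w k), zt k) - w k)"
      using M_norm_sq_ge[of "(fst (w k), zt k) - w k" A B] by simp
    then have "t\<^sup>2 / (2 * \<gamma>_lim) \<le> M_norm_sq A B ((fst (w k), zt k) - w k) / (2 * \<gamma> k)"
      using \<gamma>_pos[of k] \<gamma>_le[of k] by (intro frac_le M_norm_sq_nonneg) auto
    then have "t\<^sup>2 / (2 * \<gamma>_lim) \<le> b + t * norm v"
      using le auv[rule_format, of k "zt k"] zero_norm_nonneg[OF mu, of "zt k"] fu ztv
      unfolding model_def b_def by linarith
    then have sq: "t * t \<le> 2 * \<gamma>_lim * (b + t * norm v)"
      using \<gamma>_lim_pos by (simp add: field_simps power2_eq_square)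
    \<comment> \<open>The quadratic inequality is solved without a square root: either t is at most
      1, or one factor t divides out.\<close>
    have "t \<le> 1 + 2 * \<gamma>_lim * (b + norm v)"
    proof (cases "t \<le> 1")
      case True
      then show ?thesis using b \<gamma>_lim_pos by (simp add: add_increasing2)
    next
      case False
      then have "b + t * norm v \<le> t * (b + norm v)"
        using b mult_right_mono[of 1 t b] by (simp add: distrib_left)
      then have "2 * \<gamma>_lim * (b + t * norm v) \<le> t * (2 * \<gamma>_lim * (b + norm v))"
        using \<gamma>_lim_pos by (simp add: mult.left_commute)
      then have "t * t \<le> t * (2 * \<gamma>_lim * (b + norm v))" using sq by linarith
      then show ?thesis using False by simp
    qed
    then show ?thesis
      using n(2)[of k] norm_triangle_ineq[of "zt k - snd (w k)" "snd (w k)"] by (simp add: t_def)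
  qed
  moreover have "0 \<le> W + (1 + 2 * \<gamma>_lim * (b + norm v))" using W(1) b \<gamma>_lim_pos by simp
  ultimately show thesis by (intro that)
qed

text \<open>Resetting a nonzero coordinate to zero gains the jump \<open>mu $ i\<close> of the zero norm and
  costs at most a Lipschitz constant times the coordinate.\<close>

lemma jump_bound:
  obtains L where "0 \<le> L"
    "\<And>k i. snd (w k) $ i \<noteq> 0 \<Longrightarrow>
       mu $ i \<le> L * \<bar>snd (w k) $ i\<bar> + (dual_value k - model k (zt k))"
proof -
  obtain W where W: "0 < W" "\<And>k. norm (w k) \<le> W"
    and n: "\<And>k. norm (fst (w k)) \<le> W" "\<And>k. norm (snd (w k)) \<le> W"
    using obtain_w_bound by blast
  obtain Z where Z: "0 \<le> Z" "\<And>k. norm (zt k) \<le> Z" using zt_bounded by blast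
  obtain q where q: "0 \<le> q" "\<And>v. norm (Q_adj A B v) \<le> norm v * q"
    using bounded_linear.nonneg_bounded[OF linear_conv_bounded_linear[THEN iffD1, OF linear_Q_adj[of A B]]]
    by blast
  \<comment> \<open>Bounds every mixed point met during a sweep, by the l1 norm: each coordinate is
    at most \<open>W + Z\<close>.\<close>
  define R where "R = W + real CARD('p) * (W + Z)"
  have R: "0 \<le> R" using W Z by (simp add: R_def)
  obtain L where L: "0 \<le> L"
    "\<And>y y'. norm y \<le> R * q \<Longrightarrow> norm y' \<le> R * q \<Longrightarrow> fc y - fc y' \<le> L * norm (y - y')"
    using F.conj_lipschitz_on_ball unfolding fc_def by metis
  \<comment> \<open>The first summand is the Lipschitz cost of the conjugate of \<open>f\<close>,
    the second the cost of the proximal term, made uniform in \<open>k\<close> by gamma_0.\<close>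
  define L' where "L' = L * q + (R + W) * (q * q + 1) / \<gamma> 0"
  have "mu $ i \<le> L' * \<bar>snd (w k) $ i\<bar> + (dual_value k - model k (zt k))"
    if nz: "snd (w k) $ i \<noteq> 0" for k i
  proof -
    define s where "s = snd (w k) $ i"
    define v where "v = gs_vec (zt k) (snd (w k)) i"
    define p where "p t = (fst (w k), v t)" for t
    have p: "norm (p t) \<le> R" if "\<bar>t\<bar> \<le> W" for t
    proof -
      have "\<bar>v t $ j\<bar> \<le> W + Z" for j
        using component_le_norm_cart[of "zt k" j] component_le_norm_cart[of "snd (w k)" j]
          n(2)[of k] Z(2)[of k] Z(1) W(1) that by (auto simp: v_def gs_vec_def)
      then have "(\<Sum>j\<in>UNIV. \<bar>v t $ j\<bar>) \<le> real CARD('p) * (W + Z)"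
        by (rule sum_bounded_above)
      then have "norm (v t) \<le> real CARD('p) * (W + Z)" using norm_le_l1_cart order_trans by blast
      moreover have "norm (p t) \<le> norm (fst (w k)) + norm (v t)"
        unfolding p_def by (rule norm_Pair_le)
      ultimately show ?thesis using n(1)[of k] by (simp add: R_def)
    qed
    have s: "\<bar>s\<bar> \<le> W" using component_le_norm_cart[of "snd (w k)" i] n(2)[of k] by (simp add: s_def)
    have Qp: "norm (Q_adj A B (p t)) \<le> R * q" if "\<bar>t\<bar> \<le> W" for t
      using q(2)[of "p t"] mult_right_mono[OF p[OF that] q(1)] by linarith
    have "p 0 - p s = (0, (- s) *\<^sub>R axis i 1)"
      by (auto simp: p_def v_def gs_vec_def vec_eq_iff axis_def)
    then have diff: "norm (p 0 - p s) = \<bar>s\<bar>" by simp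
    have Qdiff: "norm (Q_adj A B (p 0 - p s)) \<le> \<bar>s\<bar> * q" using q(2)[of "p 0 - p s"] diff by simp
    have "fc (- Q_adj A B (p 0)) - fc (- Q_adj A B (p s))
        \<le> L * norm (- Q_adj A B (p 0) - - Q_adj A B (p s))"
      using Qp[of 0] Qp[OF s] W(1) by (intro L(2)) auto
    also have "- Q_adj A B (p 0) - - Q_adj A B (p s) = - Q_adj A B (p 0 - p s)"
      by (simp add: Q_adj_diff)
    also have "L * norm (- Q_adj A B (p 0 - p s)) \<le> L * q * \<bar>s\<bar>"
      using mult_left_mono[OF Qdiff L(1)] by (simp add: algebra_simps)
    finally have 1: "fc (- Q_adj A B (p 0)) - fc (- Q_adj A B (p s)) \<le> L * q * \<bar>s\<bar>" .

    define e where "e = p 0 - w k"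
    have e: "norm e \<le> R + W" 
      using norm_triangle_ineq4[of "p 0" "w k"] p[of 0] W(1) W(2)[of k] by (simp add: e_def)
    have "M_norm_sq A B e - M_norm_sq A B (p s - w k)
        \<le> 2 * (Q_adj A B e \<bullet> Q_adj A B (p 0 - p s) + e \<bullet> (p 0 - p s))"
      using M_norm_sq_diff_le[of A B e "p s - w k"] by (simp add: e_def)
    also have "Q_adj A B e \<bullet> Q_adj A B (p 0 - p s) \<le> ((R + W) * q) * (\<bar>s\<bar> * q)"
    proof -
      have "norm (Q_adj A B e) \<le> (R + W) * q"
        using q(2)[of e] mult_right_mono[OF e q(1)] by linarith
      then show ?thesis
        using norm_cauchy_schwarz[of "Q_adj A B e" "Q_adj A B (p 0 - p s)"] Qdiff q(1) R W(1)
        by (meson mult_mono norm_ge_zero order_trans)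
    qed
    also have "e \<bullet> (p 0 - p s) \<le> (R + W) * \<bar>s\<bar>"
      using norm_cauchy_schwarz[of e "p 0 - p s"] mult_right_mono[OF e, of "\<bar>s\<bar>"] by (simp add: diff)
    finally have "M_norm_sq A B e - M_norm_sq A B (p s - w k) \<le> 2 * ((R + W) * (q * q + 1) * \<bar>s\<bar>)"
      by (simp add: algebra_simps)
    then have "(M_norm_sq A B e - M_norm_sq A B (p s - w k)) / (2 * \<gamma> k)
        \<le> 2 * ((R + W) * (q * q + 1) * \<bar>s\<bar>) / (2 * \<gamma> k)"
      using \<gamma>_pos[of k] by (intro divide_right_mono) auto
    also have "\<dots> \<le> 2 * ((R + W) * (q * q + 1) * \<bar>s\<bar>) / (2 * \<gamma> 0)"
      using \<gamma>0 \<gamma>_ge[of k] R W(1) by (intro divide_left_mono) auto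
    finally have 2: "M_norm_sq A B e / (2 * \<gamma> k) - M_norm_sq A B (p s - w k) / (2 * \<gamma> k)
        \<le> (R + W) * (q * q + 1) / \<gamma> 0 * \<bar>s\<bar>"
      by (simp add: diff_divide_distrib)

    have "zero_norm mu (v s) - (if v s $ i \<noteq> 0 then mu $ i else 0)
        = zero_norm mu (v 0) - (if v 0 $ i \<noteq> 0 then mu $ i else 0)"
      by (rule zero_norm_coordinate) (simp add: v_def gs_vec_def)
    then have 3: "zero_norm mu (v s) = zero_norm mu (v 0) + mu $ i"
      using nz by (simp add: v_def gs_vec_def s_def)
    \<comment> \<open>The competitor is \<open>t = 0\<close>: \<open>v s\<close> still carries the
      old coordinate and \<open>v 0\<close> is the reset.\<close>
    have "model k (v s) - model k (v 0) \<le> dual_value k - model k (zt k)"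
      unfolding v_def s_def by (rule sweep_decrease)
    then show ?thesis
      using 1 2 3 by (simp add: model_def p_def e_def L'_def s_def[symmetric] algebra_simps)
  qed
  moreover have "0 \<le> L'"
    unfolding L'_def using L(1) q(1) R W(1) \<gamma>0 by simp
  ultimately show thesis using that by blast
qed

text \<open>Eventually nonzero coordinates have size at least delta while steps are shorter than
  delta, so no coordinate can enter or leave zero.\<close>

lemma support_identification:
  obtains K S where "\<And>k. K \<le> k \<Longrightarrow> supp (snd (w k)) = S" "\<And>k. K \<le> k \<Longrightarrow> supp (zt k) = S"
proof -
  obtain L where L: "0 \<le> L" "\<And>k i. snd (w k) $ i \<noteq> 0 \<Longrightarrow>
       mu $ i \<le> L * \<bar>snd (w k) $ i\<bar> + (dual_value k - model k (zt k))"
    using jump_bound by blast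
  define m where "m = Min (range (($) mu))"
  have m: "0 < m" "\<And>i. m \<le> mu $ i" using mu by (auto simp: m_def)
  \<comment> \<open>The decrease uses up at most half of the smallest jump \<open>m\<close>, so L
    |z_i| is at least m/2; the 1 covers \<open>L = 0\<close>.\<close>
  define \<delta> where "\<delta> = m / (2 * (L + 1))"
  have \<delta>: "0 < \<delta>" using m(1) L(1) by (simp add: \<delta>_def)
  have "\<forall>\<^sub>F k in sequentially. dual_value k - dual_value (Suc k) < m / 2"
    using dual_value_decrease_tendsto m(1) by (intro order_tendstoD) auto
  moreover have "\<forall>\<^sub>F k in sequentially. norm (w (Suc k) - w k) < \<delta>"
    using tendsto_norm_zero[OF w_step_tendsto] \<delta> by (intro order_tendstoD) auto
  ultimately have "\<forall>\<^sub>F k in sequentially. dual_value k - dual_value (Suc k) < m / 2 \<and>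
      norm (w (Suc k) - w k) < \<delta>"
    by (rule eventually_conj)
  then obtain K where K: "\<And>k. K \<le> k \<Longrightarrow> dual_value k - dual_value (Suc k) < m / 2"
    "\<And>k. K \<le> k \<Longrightarrow> norm (w (Suc k) - w k) < \<delta>"
    unfolding eventually_sequentially by blast
  have decr: "dual_value (Suc k) + (zero_norm mu (zt k) - zero_norm mu (snd (w (Suc k)))) \<le> model k (zt k)"
    for k
  proof -
    have "0 \<le> (norm (w (Suc k) - w k))\<^sup>2 / (4 * \<gamma>_lim)" using \<gamma>_lim_pos by simp
    then show ?thesis using dual_value_decrease[of k] by linarith
  qed
  have big: "\<delta> \<le> \<bar>snd (w k) $ i\<bar>" if k: "K \<le> k" and nz: "snd (w k) $ i \<noteq> 0" for k i
  proof -
    have "m / 2 \<le> L * \<bar>snd (w k) $ i\<bar>"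
      using L(2)[OF nz] m(2)[of i] K(1)[OF k] decr[of k] zero_norm_supp_mono[OF mu supp_update[of k]]
      by linarith
    also have "\<dots> \<le> (L + 1) * \<bar>snd (w k) $ i\<bar>" by (simp add: distrib_right)
    finally show ?thesis using L(1) by (simp add: \<delta>_def field_simps)
  qed
  have near: "\<bar>snd (w (Suc k)) $ i - snd (w k) $ i\<bar> < \<delta>" if "K \<le> k" for k i
    using component_le_norm_cart[of "snd (w (Suc k) - w k)" i] K(2)[OF that]
      norm_fst_snd_le(2)[of "w (Suc k) - w k"] by simp
  have step: "supp (snd (w (Suc k))) = supp (snd (w k))" if "K \<le> k" for k
  proof -
    have "snd (w (Suc k)) $ i = 0 \<longleftrightarrow> snd (w k) $ i = 0" for i
      using big[of k i] big[of "Suc k" i] near[OF that, of i] that by fastforce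
    then show ?thesis by (simp add: supp_def)
  qed
  have const: "supp (snd (w k)) = supp (snd (w K))" if "K \<le> k" for k
    using that by (induction k rule: dec_induct) (simp_all add: step)
  \<comment> \<open>An index of \<open>zt k\<close> lost in the Newton phase would lower the dual
    value by at least \<open>m\<close> at once.\<close>
  have "supp (zt k) \<subseteq> supp (snd (w (Suc k)))" if "K \<le> k" for k
  proof (rule ccontr)
    assume "\<not> ?thesis"
    then obtain i where "i \<in> supp (zt k)" "i \<notin> supp (snd (w (Suc k)))" by auto
    then have "zero_norm mu (snd (w (Suc k))) + mu $ i \<le> zero_norm mu (zt k)"
      by (intro zero_norm_supp_strict[OF mu supp_update])
    then show False
      using decr[of k] sweep_decrease(2)[of k] K(1)[OF that] m(2)[of i] m(1) by linarith
  qed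
  then have "supp (zt k) = supp (snd (w K))" if "K \<le> k" for k
    using supp_update[of k] const[of "Suc k"] that by auto
  then show thesis using const that by blast
qed

end

context ppsna_run
begin

subsection \<open>Convergence\<close>

text \<open>The term \<open>(1 / 2) ^ k\<close> leaves room for near-minimizers of the Moreau envelopes, so that
  their proximal points need not be shown to exist.\<close>

definition "tol k = \<epsilon> k / \<gamma> k + (1 / 2) ^ k"

lemma tol_pos: "0 < tol k"
  using \<epsilon>_nonneg[of k] \<gamma>_pos[of k] by (auto simp: tol_def intro: add_nonneg_pos)

lemma tol_summable: "summable tol"
proof -
  have "summable (\<lambda>k. \<epsilon> k / \<gamma> 0 + (1 / 2) ^ k)"
    by (intro summable_add summable_divide \<epsilon>_summable summable_geometric) simp
  moreover have "norm (tol k) \<le> \<epsilon> k / \<gamma> 0 + (1 / 2) ^ k" for k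
    using tol_pos[of k] \<epsilon>_nonneg[of k] \<gamma>0 \<gamma>_ge[of k]
    by (auto simp: tol_def intro: divide_left_mono)
  ultimately show ?thesis by (rule summable_comparison_test'[where N = 0])
qed

lemma tol_tendsto: "tol \<longlonglongrightarrow> 0"
  by (rule summable_LIMSEQ_zero) (rule tol_summable)

definition "gap_tol k = \<gamma> k / 2 * (tol k)\<^sup>2"

lemma gap_tol_le: "gap_tol k \<le> \<gamma>_lim / 2 * (tol k)\<^sup>2"
  unfolding gap_tol_def using \<gamma>_le[of k] by (intro mult_right_mono) auto

lemma gap_tol_tendsto: "gap_tol \<longlonglongrightarrow> 0"
proof (rule Lim_null_comparison)
  show "\<forall>\<^sub>F k in sequentially. norm (gap_tol k) \<le> \<gamma>_lim / 2 * (tol k)\<^sup>2"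
    using gap_tol_le \<gamma>_pos by (simp add: gap_tol_def less_imp_le)
  have "(\<lambda>k. \<gamma>_lim / 2 * (tol k)\<^sup>2) \<longlonglongrightarrow> \<gamma>_lim / 2 * 0\<^sup>2"
    by (intro tendsto_intros tol_tendsto)
  then show "(\<lambda>k. \<gamma>_lim / 2 * (tol k)\<^sup>2) \<longlonglongrightarrow> 0" by simp
qed

text \<open>\<open>xp k\<close> and \<open>up k\<close> replace the proximal points of
  \<open>f\<close> and \<open>g\<close>. The norm bounds are the optimality conditions of the two
  envelopes up to \<open>tol k\<close>.\<close>

lemma approximate_subgradients:
  obtains xp up where
    "\<And>k. f (xp k) + fenchel_conj f (- Q_adj A B (w (Suc k)))
      \<le> ereal (- Q_adj A B (w (Suc k)) \<bullet> xp k + gap_tol k)"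
    "\<And>k. norm (xp k - x (Suc k) + (1 / \<gamma> k) *\<^sub>R (Q_adj A B (w k) - Q_adj A B (w (Suc k)))) \<le> tol k"
    "\<And>k. g (up k) + fenchel_conj g (fst (w (Suc k))) \<le> ereal (fst (w (Suc k)) \<bullet> up k + gap_tol k)"
    "\<And>k. norm (up k - A *v x (Suc k) + (1 / \<gamma> k) *\<^sub>R (fst (w (Suc k)) - fst (w k))) \<le> tol k"
proof -
  have "\<exists>xp up. f xp + fenchel_conj f (- Q_adj A B (w (Suc k)))
      \<le> ereal (- Q_adj A B (w (Suc k)) \<bullet> xp + gap_tol k) \<and>
    norm (xp - x (Suc k) + (1 / \<gamma> k) *\<^sub>R (Q_adj A B (w k) - Q_adj A B (w (Suc k)))) \<le> tol k \<and>
    g up + fenchel_conj g (fst (w (Suc k))) \<le> ereal (fst (w (Suc k)) \<bullet> up + gap_tol k) \<and>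
    norm (up - A *v x (Suc k) + (1 / \<gamma> k) *\<^sub>R (fst (w (Suc k)) - fst (w k))) \<le> tol k" for k
    by (rule duality_gap_control[OF F.superlinear_function_axioms G.proper_function_axioms
          \<gamma>_pos \<epsilon>_nonneg _ z_update C2 tol_def]) (auto simp: gap_tol_def)
  then show thesis using that by metis
qed

lemma subgradient_points_close:
  assumes "\<And>k. norm (xp k - x (Suc k) + (1 / \<gamma> k) *\<^sub>R (Q_adj A B (w k) - Q_adj A B (w (Suc k)))) \<le> tol k"
    and "\<And>k. norm (up k - A *v x (Suc k) + (1 / \<gamma> k) *\<^sub>R (fst (w (Suc k)) - fst (w k))) \<le> tol k"
  shows "(\<lambda>k. xp k - x (Suc k)) \<longlonglongrightarrow> 0" "(\<lambda>k. up k - A *v x (Suc k)) \<longlonglongrightarrow> 0"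
proof -
  have bound: "norm v \<le> tol k + norm u / \<gamma> 0"
    if "norm (v + (1 / \<gamma> k) *\<^sub>R u) \<le> tol k" for v u :: "'x::real_normed_vector" and k
  proof -
    have "norm v \<le> norm (v + (1 / \<gamma> k) *\<^sub>R u) + norm ((1 / \<gamma> k) *\<^sub>R u)"
      using norm_triangle_ineq4[of "v + (1 / \<gamma> k) *\<^sub>R u" "(1 / \<gamma> k) *\<^sub>R u"] by simp
    also have "norm ((1 / \<gamma> k) *\<^sub>R u) \<le> norm u / \<gamma> 0"
      using \<gamma>0 \<gamma>_ge[of k] \<gamma>_pos[of k] by (auto intro: divide_left_mono)
    finally show ?thesis using that by linarith
  qed
  have "(\<lambda>k. Q_adj A B (w (Suc k) - w k)) \<longlonglongrightarrow> Q_adj A B 0"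
    by (rule tendsto_Q_adj[OF w_step_tendsto])
  then have "(\<lambda>k. - Q_adj A B (w (Suc k) - w k)) \<longlonglongrightarrow> - 0"
    by (intro tendsto_minus) (simp add: linear_0[OF linear_Q_adj])
  then have Q: "(\<lambda>k. Q_adj A B (w k) - Q_adj A B (w (Suc k))) \<longlonglongrightarrow> 0"
    by (simp add: Q_adj_diff)
  have y: "(\<lambda>k. fst (w (Suc k)) - fst (w k)) \<longlonglongrightarrow> 0"
    using tendsto_fst[OF w_step_tendsto] by simp
  have "(\<lambda>k. tol k + norm (Q_adj A B (w k) - Q_adj A B (w (Suc k))) / \<gamma> 0) \<longlonglongrightarrow> 0 + 0 / \<gamma> 0"
    using \<gamma>0 by (intro tendsto_intros tol_tendsto tendsto_norm_zero Q) auto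
  then have "(\<lambda>k. tol k + norm (Q_adj A B (w k) - Q_adj A B (w (Suc k))) / \<gamma> 0) \<longlonglongrightarrow> 0" by simp
  then show "(\<lambda>k. xp k - x (Suc k)) \<longlonglongrightarrow> 0"
    by (rule Lim_null_comparison[rotated]) (simp add: bound assms(1))
  have "(\<lambda>k. tol k + norm (fst (w (Suc k)) - fst (w k)) / \<gamma> 0) \<longlonglongrightarrow> 0 + 0 / \<gamma> 0"
    using \<gamma>0 by (intro tendsto_intros tol_tendsto tendsto_norm_zero y) auto
  then have "(\<lambda>k. tol k + norm (fst (w (Suc k)) - fst (w k)) / \<gamma> 0) \<longlonglongrightarrow> 0" by simp
  then show "(\<lambda>k. up k - A *v x (Suc k)) \<longlonglongrightarrow> 0"
    by (rule Lim_null_comparison[rotated]) (simp add: bound assms(2))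
qed

section \<open>Boundedness of the primal iterates\<close>

lemma Q_adj_w_bounded: obtains V where "\<And>k. norm (Q_adj A B (w k)) \<le> V"
proof -
  have "bounded (Q_adj A B ` range w)"
    by (rule bounded_linear_image[OF bounded_w])
      (rule linear_conv_bounded_linear[THEN iffD1, OF linear_Q_adj])
  then show thesis using that unfolding bounded_iff by blast
qed

text \<open>The points \<open>xp k\<close> have bounded Fenchel gap at bounded slopes, so
  superlinearity of \<open>f\<close> bounds them, and they are close to the iterates.\<close>

lemma x_bounded: "bounded (range (\<lambda>k. x (Suc k)))"
proof -
  obtain xp up where gap: "\<And>k. f (xp k) + fenchel_conj f (- Q_adj A B (w (Suc k)))
      \<le> ereal (- Q_adj A B (w (Suc k)) \<bullet> xp k + gap_tol k)"
    and close: "\<And>k. norm (xp k - x (Suc k) + (1 / \<gamma> k) *\<^sub>R (Q_adj A B (w k) - Q_adj A B (w (Suc k)))) \<le> tol k"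
      "\<And>k. norm (up k - A *v x (Suc k) + (1 / \<gamma> k) *\<^sub>R (fst (w (Suc k)) - fst (w k))) \<le> tol k"
    using approximate_subgradients by metis
  obtain E where "\<And>k. norm (gap_tol k) \<le> E"
    using convergent_imp_Bseq[OF convergentI[OF gap_tol_tendsto]] unfolding Bseq_def by blast
  then have E: "gap_tol k \<le> E" for k by (simp add: abs_le_D1)
  obtain V where V: "\<And>k. norm (Q_adj A B (w k)) \<le> V" using Q_adj_w_bounded by blast
  obtain R where R: "0 \<le> R"
    "\<And>x y. norm y \<le> V \<Longrightarrow> f x + fenchel_conj f y \<le> ereal (y \<bullet> x + E) \<Longrightarrow> norm x \<le> R"
    using F.approx_subgradient_bounded by metis
  have xp: "norm (xp k) \<le> R" for k
  proof (rule R(2))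
    show "norm (- Q_adj A B (w (Suc k))) \<le> V" using V by simp
    show "f (xp k) + fenchel_conj f (- Q_adj A B (w (Suc k))) \<le> ereal (- Q_adj A B (w (Suc k)) \<bullet> xp k + E)"
      using gap[of k] by (rule order_trans) (simp add: E)
  qed
  have "Bseq (\<lambda>k. xp k - x (Suc k))"
    using subgradient_points_close(1)[OF close] by (intro convergent_imp_Bseq convergentI)
  then obtain D where D: "\<And>k. norm (xp k - x (Suc k)) \<le> D" unfolding Bseq_def by blast
  have "norm (x (Suc k)) \<le> R + D" for k
    using norm_triangle_ineq4[of "xp k" "xp k - x (Suc k)"] xp[of k] D[of k] by simp
  then show ?thesis unfolding bounded_iff by blast
qed

text \<open>The optimality system of the convex problem with support fixed to \<open>S\<close>, in
  Fenchel equality form. Since \<open>B *v xl\<close> vanishes on \<open>S\<close> and the z-part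
  off \<open>S\<close>, each is a subgradient of the zero norm at the other: one system yields both
  stationarity conditions.\<close>

definition saddle :: "'p set \<Rightarrow> real^'n \<Rightarrow> (real^'m) \<times> (real, 'p) vec \<Rightarrow> bool"
  where "saddle S xl wl \<longleftrightarrow>
    f xl + fenchel_conj f (- Q_adj A B wl) \<le> ereal (- Q_adj A B wl \<bullet> xl) \<and>
    g (A *v xl) + fenchel_conj g (fst wl) \<le> ereal (fst wl \<bullet> (A *v xl)) \<and>
    (\<forall>i\<in>S. (B *v xl) $ i = 0) \<and> (\<forall>i. i \<notin> S \<longrightarrow> snd wl $ i = 0)"

lemma saddle_stationary_primal:
  assumes lam: "\<forall>i. lam $ i > 0" and "saddle S xl wl"
  shows "stationary_primal f g A B lam xl"
  unfolding stationary_primal_def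
proof (intro bexI)
  show "- Q_adj A B wl \<in> subdiff f xl" "fst wl \<in> subdiff g (A *v xl)"
    using assms(2) by (auto simp: saddle_def intro: F.fenchel_equality_subdiff G.fenchel_equality_subdiff)
  show "snd wl \<in> limiting_subdiff (\<lambda>u. ereal (zero_norm lam u)) (B *v xl)"
    using assms(2) by (auto simp: saddle_def limiting_subdiff_zero_norm[OF lam])
  show "- Q_adj A B wl + transpose A *v fst wl + transpose B *v snd wl = 0"
    by (simp add: Q_adj_def)
qed

lemma saddle_stationary_dual:
  assumes "saddle S xl wl"
  shows "stationary_dual f g A B mu wl"
  unfolding stationary_dual_def
proof (intro bexI conjI)
  show "xl \<in> subdiff (fenchel_conj f) (- Q_adj A B wl)"
    "A *v xl \<in> subdiff (fenchel_conj g) (fst wl)"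
    using assms by (auto simp: saddle_def intro: F.fenchel_equality_subdiff G.fenchel_equality_subdiff)
  show "B *v xl \<in> limiting_subdiff (\<lambda>u. ereal (zero_norm mu u)) (snd wl)"
    using assms by (auto simp: saddle_def limiting_subdiff_zero_norm[OF mu])
qed

section \<open>Iterations with constant support\<close>

context
  fixes K S
  assumes supp_z: "\<And>k. K \<le> k \<Longrightarrow> supp (snd (w k)) = S"
    and supp_zt: "\<And>k. K \<le> k \<Longrightarrow> supp (zt k) = S"
begin

lemma z_zero: "K \<le> k \<Longrightarrow> i \<notin> S \<Longrightarrow> snd (w k) $ i = 0"
  using supp_z[of k] by (auto simp: supp_def)

text \<open>Off \<open>S\<close> the old z-part is already zero, so the truncation changes nothing
  there; the update is a pure multiplier step for the constraint (Bx)_S = 0.\<close>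

lemma z_step: "K \<le> k \<Longrightarrow> snd (w (Suc k)) - snd (w k) = \<gamma> k *\<^sub>R restrict_rows S (B *v x (Suc k))"
  unfolding z_update using supp_zt[of k] z_zero[of k] by (auto simp: vec_eq_iff restrict_rows_nth)

text \<open>The Fenchel gaps pass to the limit along \<open>xp\<close> and \<open>up\<close>, which
  share the limits of x^{k+1} and A x^{k+1}; on \<open>S\<close> the entries of B x^{k+1} are steps
  of z divided by gamma_k, hence null.\<close>

lemma cluster_point_saddle:
  assumes s: "strict_mono s" and xl: "(\<lambda>j. x (Suc (s j))) \<longlonglongrightarrow> xl"
    and wl: "(\<lambda>j. w (Suc (s j))) \<longlonglongrightarrow> wl"
  shows "saddle S xl wl"
proof -
  obtain xp up where f_gap: "\<And>k. f (xp k) + fenchel_conj f (- Q_adj A B (w (Suc k)))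
      \<le> ereal (- Q_adj A B (w (Suc k)) \<bullet> xp k + gap_tol k)"
    and g_gap: "\<And>k. g (up k) + fenchel_conj g (fst (w (Suc k))) \<le> ereal (fst (w (Suc k)) \<bullet> up k + gap_tol k)"
    and close: "\<And>k. norm (xp k - x (Suc k) + (1 / \<gamma> k) *\<^sub>R (Q_adj A B (w k) - Q_adj A B (w (Suc k)))) \<le> tol k"
      "\<And>k. norm (up k - A *v x (Suc k) + (1 / \<gamma> k) *\<^sub>R (fst (w (Suc k)) - fst (w k))) \<le> tol k"
    using approximate_subgradients by metis
  note sub = filterlim_compose[OF _ filterlim_subseq[OF s]]
  have es: "(\<lambda>j. gap_tol (s j)) \<longlonglongrightarrow> 0" by (rule sub[OF gap_tol_tendsto])
  have "(\<lambda>j. (xp (s j) - x (Suc (s j))) + x (Suc (s j))) \<longlonglongrightarrow> 0 + xl"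
    by (intro tendsto_add xl sub[OF subgradient_points_close(1)[OF close]])
  then have xps: "(\<lambda>j. xp (s j)) \<longlonglongrightarrow> xl" by simp
  have "(\<lambda>j. (up (s j) - A *v x (Suc (s j))) + A *v x (Suc (s j))) \<longlonglongrightarrow> 0 + A *v xl"
    by (intro tendsto_add tendsto_matrix_vector_mult xl sub[OF subgradient_points_close(2)[OF close]])
  then have ups: "(\<lambda>j. up (s j)) \<longlonglongrightarrow> A *v xl" by simp
  have 1: "f xl + fenchel_conj f (- Q_adj A B wl) \<le> ereal (- Q_adj A B wl \<bullet> xl)"
    by (rule F.fenchel_gap_limit[OF xps tendsto_minus[OF tendsto_Q_adj[OF wl]] es f_gap])
  have 2: "g (A *v xl) + fenchel_conj g (fst wl) \<le> ereal (fst wl \<bullet> (A *v xl))"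
    by (rule G.fenchel_gap_limit[OF ups tendsto_fst[OF wl] es g_gap])
  have large: "\<forall>\<^sub>F j in sequentially. K \<le> s j"
    using filterlim_subseq[OF s] by (simp add: filterlim_at_top)
  have 3: "(B *v xl) $ i = 0" if "i \<in> S" for i
  proof (rule LIMSEQ_unique)
    show "(\<lambda>j. (B *v x (Suc (s j))) $ i) \<longlonglongrightarrow> (B *v xl) $ i"
      by (intro tendsto_vec_nth tendsto_matrix_vector_mult xl)
    show "(\<lambda>j. (B *v x (Suc (s j))) $ i) \<longlonglongrightarrow> 0"
    proof (rule Lim_null_comparison)
      show "\<forall>\<^sub>F j in sequentially. norm ((B *v x (Suc (s j))) $ i) \<le> norm (w (Suc (s j)) - w (s j)) / \<gamma> 0"
        using large
      proof eventually_elim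
        case (elim j)
        let ?k = "s j"
        have "\<gamma> 0 * \<bar>(B *v x (Suc ?k)) $ i\<bar> \<le> \<gamma> ?k * \<bar>(B *v x (Suc ?k)) $ i\<bar>"
          by (intro mult_right_mono \<gamma>_ge) simp
        also have "\<dots> = \<bar>(snd (w (Suc ?k)) - snd (w ?k)) $ i\<bar>"
          unfolding z_step[OF elim] using that \<gamma>_pos[of ?k] by (simp add: restrict_rows_nth abs_mult)
        also have "\<dots> \<le> norm (snd (w (Suc ?k) - w ?k))"
          unfolding snd_diff by (rule component_le_norm_cart)
        also have "\<dots> \<le> norm (w (Suc ?k) - w ?k)" by (rule norm_fst_snd_le)
        finally show ?case using \<gamma>0 by (simp add: field_simps)
      qed
      have "(\<lambda>j. norm (w (Suc (s j)) - w (s j)) / \<gamma> 0) \<longlonglongrightarrow> 0 / \<gamma> 0"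
        using \<gamma>0 by (intro tendsto_intros tendsto_norm_zero sub[OF w_step_tendsto]) auto
      then show "(\<lambda>j. norm (w (Suc (s j)) - w (s j)) / \<gamma> 0) \<longlonglongrightarrow> 0" by simp
    qed
  qed
  have 4: "snd wl $ i = 0" if "i \<notin> S" for i
  proof (rule LIMSEQ_unique)
    show "(\<lambda>j. snd (w (Suc (s j))) $ i) \<longlonglongrightarrow> snd wl $ i"
      by (intro tendsto_vec_nth tendsto_snd wl)
    show "(\<lambda>j. snd (w (Suc (s j))) $ i) \<longlonglongrightarrow> 0"
      using large by (intro tendsto_eventually) (auto elim!: eventually_mono simp: z_zero that)
  qed
  show ?thesis using 1 2 3 4 by (simp add: saddle_def)
qed

text \<open>Approximate monotonicity at the saddle bounds <a, M d> by a multiple of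
  \<open>tol k\<close>, with a the new error and d the step; \<open>M_norm_sq_diff_le\<close>
  converts this into the change of the squared M-distance.\<close>

lemma quasi_Fejer:
  assumes saddle: "saddle S xl wl"
  obtains C where "\<And>k. K \<le> k \<Longrightarrow>
    M_norm_sq A B (w (Suc k) - wl) \<le> M_norm_sq A B (w k - wl) + C * tol k"
proof -
  obtain xp up where f_gap: "\<And>k. f (xp k) + fenchel_conj f (- Q_adj A B (w (Suc k)))
      \<le> ereal (- Q_adj A B (w (Suc k)) \<bullet> xp k + gap_tol k)"
    and g_gap: "\<And>k. g (up k) + fenchel_conj g (fst (w (Suc k))) \<le> ereal (fst (w (Suc k)) \<bullet> up k + gap_tol k)"
    and xp: "\<And>k. norm (xp k - x (Suc k) + (1 / \<gamma> k) *\<^sub>R (Q_adj A B (w k) - Q_adj A B (w (Suc k)))) \<le> tol k"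
    and up: "\<And>k. norm (up k - A *v x (Suc k) + (1 / \<gamma> k) *\<^sub>R (fst (w (Suc k)) - fst (w k))) \<le> tol k"
    using approximate_subgradients by metis
  obtain W where W: "0 < W" "\<And>k. norm (fst (w k)) \<le> W" using obtain_w_bound by metis
  obtain V where V: "\<And>k. norm (Q_adj A B (w k)) \<le> V" using Q_adj_w_bounded by blast
  obtain P where "\<And>k. norm (tol k) \<le> P"
    using convergent_imp_Bseq[OF convergentI[OF tol_tendsto]] unfolding Bseq_def by blast
  then have P: "tol k \<le> P" for k by (simp add: abs_le_D1)
  \<comment> \<open>Bounds |Q^T a| + |a_y|, the factors that multiply the residuals \<open>r\<close>
    and \<open>r'\<close>.\<close>
  define C1 where "C1 = V + norm (Q_adj A B wl) + (W + norm (fst wl))"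
  have C1: "0 \<le> C1"
    unfolding C1_def using W(1) order_trans[OF norm_ge_zero V[of 0]] by simp
  have "M_norm_sq A B (w (Suc k) - wl)
      \<le> M_norm_sq A B (w k - wl) + 2 * (\<gamma>_lim * (\<gamma>_lim * P + C1)) * tol k" if k: "K \<le> k" for k
  proof -
    define a d where "a = w (Suc k) - wl" and "d = w (Suc k) - w k"
    define Qa Qd where "Qa = Q_adj A B a" and "Qd = Q_adj A B d"
    define r where "r = xp k - x (Suc k) - (1 / \<gamma> k) *\<^sub>R Qd"
    define r' where "r' = up k - A *v x (Suc k) + (1 / \<gamma> k) *\<^sub>R fst d"
    let ?e = "x (Suc k) - xl"
    have "Q_adj A B (w k) - Q_adj A B (w (Suc k)) = - Qd" by (simp add: Qd_def d_def Q_adj_diff)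
    then have r: "norm r \<le> tol k" using xp[of k] by (simp add: r_def)
    have r': "norm r' \<le> tol k" using up[of k] by (simp add: r'_def d_def)

    have "- gap_tol k \<le> (- Q_adj A B (w (Suc k)) - - Q_adj A B wl) \<bullet> (xp k - xl)"
      using saddle f_gap[of k] by (intro F.fenchel_gap_monotone) (auto simp: saddle_def)
    also have "- Q_adj A B (w (Suc k)) - - Q_adj A B wl = - Qa" by (simp add: Qa_def a_def Q_adj_diff)
    also have "xp k - xl = ?e + (1 / \<gamma> k) *\<^sub>R Qd + r" by (simp add: r_def)
    finally have 1: "Qa \<bullet> ?e + Qa \<bullet> Qd / \<gamma> k + Qa \<bullet> r \<le> gap_tol k"
      by (simp add: inner_add_right)
    have "- gap_tol k \<le> (fst (w (Suc k)) - fst wl) \<bullet> (up k - A *v xl)"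
      using saddle g_gap[of k] by (intro G.fenchel_gap_monotone) (auto simp: saddle_def)
    also have "fst (w (Suc k)) - fst wl = fst a" by (simp add: a_def)
    also have "up k - A *v xl = A *v ?e - (1 / \<gamma> k) *\<^sub>R fst d + r'"
      by (simp add: r'_def matrix_vector_mult_diff_distrib)
    finally have 2: "fst a \<bullet> fst d / \<gamma> k - fst a \<bullet> (A *v ?e) - fst a \<bullet> r' \<le> gap_tol k"
      by (simp add: inner_add_right inner_diff_right)

    have "restrict_rows S (snd a) = snd a"
      using z_zero[of "Suc k"] k saddle by (auto simp: vec_eq_iff restrict_rows_nth a_def saddle_def)
    then have "snd a \<bullet> restrict_rows S (B *v x (Suc k)) = snd a \<bullet> (B *v x (Suc k))"
      by (metis restrict_rows_inner)
    then have "snd a \<bullet> snd d = \<gamma> k * (snd a \<bullet> (B *v x (Suc k)))"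
      using z_step[OF k] by (simp add: d_def)
    moreover have "snd a \<bullet> (B *v xl) = 0"
      by (rule inner_disjoint_supp)
        (use z_zero[of "Suc k"] k saddle in \<open>auto simp: a_def saddle_def\<close>)
    ultimately have "snd a \<bullet> (B *v ?e) = snd a \<bullet> snd d / \<gamma> k"
      using \<gamma>_pos[of k] by (simp add: matrix_vector_mult_diff_distrib inner_diff_right)
    \<comment> \<open>Added to the two monotonicity estimates, this cancels every term in x^{k+1} -
      xl and supplies the missing z-part of <a, d>.\<close>
    then have 3: "Qa \<bullet> ?e = fst a \<bullet> (A *v ?e) + snd a \<bullet> snd d / \<gamma> k"
      by (simp add: Qa_def Q_adj_inner)

    have "\<bar>Qa \<bullet> r\<bar> \<le> norm Qa * tol k" "\<bar>fst a \<bullet> r'\<bar> \<le> norm (fst a) * tol k"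
      using Cauchy_Schwarz_ineq2[of Qa r] Cauchy_Schwarz_ineq2[of "fst a" r']
        mult_left_mono[OF r, of "norm Qa"] mult_left_mono[OF r', of "norm (fst a)"] by auto
    moreover have "norm Qa + norm (fst a) \<le> C1"
      using norm_triangle_ineq4[of "Q_adj A B (w (Suc k))" "Q_adj A B wl"]
        norm_triangle_ineq4[of "fst (w (Suc k))" "fst wl"] V[of "Suc k"] W(2)[of "Suc k"]
      by (simp add: Qa_def a_def C1_def Q_adj_diff)
    then have "norm Qa * tol k + norm (fst a) * tol k \<le> C1 * tol k"
      using tol_pos[of k] by (simp flip: distrib_right)
    ultimately have "(Qa \<bullet> Qd + a \<bullet> d) / \<gamma> k \<le> 2 * gap_tol k + C1 * tol k"
      using 1 2 3 by (simp add: inner_prod_def add_divide_distrib)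
    \<comment> \<open>The quadratic error becomes linear because \<open>tol\<close> is bounded by
      \<open>P\<close>.\<close>
    also have "2 * gap_tol k \<le> \<gamma>_lim * P * tol k"
    proof -
      have "\<gamma>_lim * (tol k * tol k) \<le> \<gamma>_lim * (P * tol k)"
        using P[of k] tol_pos[of k] \<gamma>_lim_pos by (intro mult_left_mono mult_right_mono) auto
      then show ?thesis using gap_tol_le[of k] by (simp add: power2_eq_square)
    qed
    finally have "Qa \<bullet> Qd + a \<bullet> d \<le> \<gamma> k * ((\<gamma>_lim * P + C1) * tol k)"
      using \<gamma>_pos[of k] by (simp add: field_simps)
    also have "\<dots> \<le> \<gamma>_lim * ((\<gamma>_lim * P + C1) * tol k)"
      using \<gamma>_le[of k] \<gamma>_lim_pos C1 tol_pos[of k] P[of k] by (intro mult_right_mono) auto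
    finally have "Qa \<bullet> Qd + a \<bullet> d \<le> \<gamma>_lim * ((\<gamma>_lim * P + C1) * tol k)" .
    moreover have "a - (w k - wl) = d" by (simp add: a_def d_def)
    ultimately show ?thesis
      using M_norm_sq_diff_le[of A B a "w k - wl"] by (simp add: Qa_def Qd_def a_def[symmetric] mult.assoc)
  qed
  then show thesis by (rule that)
qed

end

text \<open>A joint cluster point of primal and dual iterates supplies the reference saddle. The
  distance to it is quasi-Fejer and tends to zero along a subsequence, hence along the whole
  sequence; the dual limit is then shared by all primal accumulation points.\<close>

lemma w_tendsto_saddle:
  "\<exists>S wl. w \<longlonglongrightarrow> wl \<and> (\<exists>xl. saddle S xl wl) \<and>
    (\<forall>r xl. strict_mono r \<longrightarrow> (x \<circ> r) \<longlonglongrightarrow> xl \<longrightarrow> saddle S xl wl)"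
proof -
  obtain K S where S: "\<And>k. K \<le> k \<Longrightarrow> supp (snd (w k)) = S" "\<And>k. K \<le> k \<Longrightarrow> supp (zt k) = S"
    using support_identification by blast
  have "bounded (range (\<lambda>k. x (Suc k)) \<times> range w)"
    by (intro bounded_Times x_bounded bounded_w)
  then have "bounded (range (\<lambda>k. (x (Suc k), w (Suc k))))"
    by (rule bounded_subset) auto
  then obtain l s where s: "strict_mono s" and l: "((\<lambda>k. (x (Suc k), w (Suc k))) \<circ> s) \<longlonglongrightarrow> l"
    using bounded_imp_convergent_subsequence by blast
  define xl wl where "xl = fst l" and "wl = snd l"
  have xs: "(\<lambda>j. x (Suc (s j))) \<longlonglongrightarrow> xl" using tendsto_fst[OF l] by (simp add: xl_def comp_def)
  have ws: "(\<lambda>j. w (Suc (s j))) \<longlonglongrightarrow> wl" using tendsto_snd[OF l] by (simp add: wl_def comp_def)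
  have saddle: "saddle S xl wl" by (rule cluster_point_saddle[OF S s xs ws])
  obtain C where C: "\<And>k. K \<le> k \<Longrightarrow>
      M_norm_sq A B (w (Suc k) - wl) \<le> M_norm_sq A B (w k - wl) + C * tol k"
    using quasi_Fejer[OF S saddle] by blast
  have "(\<lambda>k. M_norm_sq A B (w k - wl)) \<longlonglongrightarrow> 0"
  proof (rule quasi_Fejer_tendsto_zero[where K = K])
    show "0 \<le> M_norm_sq A B (w k - wl)" for k by (rule M_norm_sq_nonneg)
    show "M_norm_sq A B (w (Suc k) - wl) \<le> M_norm_sq A B (w k - wl) + C * tol k" if "K \<le> k" for k
      using that by (rule C)
    show "summable (\<lambda>k. C * tol k)" by (intro summable_mult tol_summable)
    show "strict_mono (Suc \<circ> s)" using s by (simp add: strict_mono_def)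
    have d: "(\<lambda>j. w (Suc (s j)) - wl) \<longlonglongrightarrow> 0" using ws by (simp add: LIM_zero)
    have "(\<lambda>j. M_norm_sq A B (w (Suc (s j)) - wl))
        \<longlonglongrightarrow> (norm (Q_adj A B 0))\<^sup>2 + (norm (0 :: (real^'m) \<times> (real, 'p) vec))\<^sup>2"
      unfolding M_norm_sq_eq by (intro tendsto_intros tendsto_Q_adj d)
    then show "((\<lambda>k. M_norm_sq A B (w k - wl)) \<circ> (Suc \<circ> s)) \<longlonglongrightarrow> 0"
      by (simp add: comp_def linear_0[OF linear_Q_adj])
  qed
  then have "(\<lambda>k. (norm (w k - wl))\<^sup>2) \<longlonglongrightarrow> 0"
    by (rule Lim_null_comparison[rotated]) (simp add: M_norm_sq_ge)
  then have "(\<lambda>k. sqrt ((norm (w k - wl))\<^sup>2)) \<longlonglongrightarrow> sqrt 0" by (rule tendsto_real_sqrt)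
  then have w: "w \<longlonglongrightarrow> wl" by (simp add: tendsto_norm_zero_iff LIM_zero_iff)
  have "saddle S xa wl" if r: "strict_mono r" and xa: "(x \<circ> r) \<longlonglongrightarrow> xa" for r xa
  proof -
    \<comment> \<open>The cluster point lemma concerns the iterates \<open>x (Suc k)\<close>.
      Dropping the first term of the subsequence, which may be \<open>x 0\<close>, makes every index
      a successor.\<close>
    define t where "t j = r (Suc j) - 1" for j
    have pos: "0 < r (Suc j)" for j using seq_suble[OF r, of "Suc j"] by linarith
    have t: "Suc (t j) = r (Suc j)" for j using pos[of j] by (simp add: t_def)
    have st: "strict_mono t"
    proof (rule strict_monoI)
      fix i j :: nat assume "i < j"
      then have "r (Suc i) < r (Suc j)" using r by (simp add: strict_mono_def)
      then show "t i < t j" using t[of i] t[of j] by linarith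
    qed
    have xt: "(\<lambda>j. x (Suc (t j))) \<longlonglongrightarrow> xa"
      using LIMSEQ_Suc[OF xa] by (simp add: t comp_def)
    have wt: "(\<lambda>j. w (Suc (t j))) \<longlonglongrightarrow> wl"
      by (rule filterlim_compose[OF LIMSEQ_Suc[OF w] filterlim_subseq[OF st]])
    show ?thesis by (rule cluster_point_saddle[OF S st xt wt])
  qed
  then show ?thesis using w saddle by blast
qed

end

theorem theorem9:
  fixes f :: "real^'n \<Rightarrow> ereal"
    and g :: "real^'m \<Rightarrow> ereal"
    and A :: "real^'n^'m"
    and B :: "real^'n^'p::{finite,linorder}"
    and lam mu :: "real^'p::{finite,linorder}"
    and \<tau> \<tau>1 \<tau>2 \<beta> \<zeta> :: real
    and \<gamma> \<epsilon> :: "nat \<Rightarrow> real"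
    and x :: "nat \<Rightarrow> real^'n"
    and w :: "nat \<Rightarrow> (real^'m) \<times> (real^'p::{finite,linorder})"
    and zt :: "nat \<Rightarrow> real^'p::{finite,linorder}"
  assumes f: "proper_closed_convex f"
    and g: "proper_closed_convex g"
    and lam: "\<forall>i. lam $ i > 0"
    and mu: "\<forall>i. mu $ i > 0"
    and alg: "ppsna f g A B mu \<tau> \<tau>1 \<tau>2 \<beta> \<zeta> \<gamma> x w zt"
    and C1: "\<forall>k. Xi_prox f g A B (\<gamma> k) (w k) (w (Suc k))
                 - Xi_prox f g A B (\<gamma> k) (w k) (fst (w k), zt k)
               \<le> ereal (M_norm_sq A B (w (Suc k) - w k) / (4 * \<gamma> k))"
    and C2: "\<forall>k. duality_gap f g A B (\<gamma> k) (w k) (supp (zt k)) (x (Suc k)) (w (Suc k))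
               \<le> ereal ((\<epsilon> k)\<^sup>2 / (2 * \<gamma> k))"
    and eps: "\<forall>k. \<epsilon> k \<ge> 0" "summable \<epsilon>"
    and coercive: "Liminf at_infinity (\<lambda>u. f u / ereal (norm u)) = \<infinity>"
    and bounded_w: "bounded (range w)"
    and cont: "continuous_on (edom (fenchel_conj g)) (fenchel_conj g)"
    and cq: "{u. u \<in> ri_or_dom f \<and> A *v u \<in> ri_or_dom g \<and>
                 (\<forall>i \<in> eventual_supp zt. (B *v u) $ i = 0)} \<noteq> {}"
  shows "(\<exists>wlim. w \<longlonglongrightarrow> wlim \<and> stationary_dual f g A B mu wlim \<and>
                 local_minimizer (dual_obj f g A B mu) wlim) \<and>
         (\<forall>xacc. (\<exists>r. strict_mono r \<and> (x \<circ> r) \<longlonglongrightarrow> xacc) \<longrightarrow>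
                 stationary_primal f g A B lam xacc \<and>
                 local_minimizer (primal_obj f g A B lam) xacc)"
proof -
  interpret F: proper_closed_function f by (rule proper_closed_convex_function[OF f])
  interpret G: proper_closed_function g by (rule proper_closed_convex_function[OF g])
  have run: "fst (w 0) \<in> edom (fenchel_conj g)" "\<gamma> 0 > 0" "incseq \<gamma>" "convergent \<gamma>"
    "\<And>k. coord_min f g A B mu (\<gamma> k) (w k) (zt k)"
    "\<And>k. w (Suc k) = dual_iterate g A B (\<gamma> k) (w k) (supp (zt k)) (x (Suc k))"
    using alg unfolding ppsna_def by blast+
  interpret ppsna_run f g A B mu \<gamma> \<epsilon> x w zt
  proof
    show "snd (w (Suc k)) = restrict_rows (supp (zt k)) (snd (w k) + \<gamma> k *\<^sub>R (B *v x (Suc k)))" for k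
      unfolding run(6)[of k] dual_iterate_def by simp
  qed (rule coercive mu run(1-5) C1[rule_format] C2[rule_format] eps(1)[rule_format] eps(2) bounded_w)+
  obtain S wl where wl: "w \<longlonglongrightarrow> wl" "\<exists>xl. saddle S xl wl"
    and acc: "\<forall>r xl. strict_mono r \<longrightarrow> (x \<circ> r) \<longlonglongrightarrow> xl \<longrightarrow> saddle S xl wl"
    using w_tendsto_saddle by blast
  have dual: "stationary_dual f g A B mu wl" using wl(2) saddle_stationary_dual by blast
  have primal: "stationary_primal f g A B lam xa"
    if "\<exists>r. strict_mono r \<and> (x \<circ> r) \<longlonglongrightarrow> xa" for xa
    using that acc saddle_stationary_primal[OF lam] by blast
  show ?thesis
  proof (intro conjI exI allI impI)
    show "w \<longlonglongrightarrow> wl" by (rule wl(1))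
    show "stationary_dual f g A B mu wl" by (rule dual)
    show "local_minimizer (dual_obj f g A B mu) wl"
      by (rule stationary_dual_local_minimizer[OF mu dual])
    fix xa assume xa: "\<exists>r. strict_mono r \<and> (x \<circ> r) \<longlonglongrightarrow> xa"
    show "stationary_primal f g A B lam xa" by (rule primal[OF xa])
    show "local_minimizer (primal_obj f g A B lam) xa"
      by (rule stationary_primal_local_minimizer[OF lam primal[OF xa]])
  qed
qed

end
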